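(* For every fixed integer $r \geq 1$ there is an algorithm that, given as input a sequence $u$ of length $n$ with $r$ distinct letters, computes $\mathrm{fw}(u)$ with worst-case run time $O(n^{r!+2})$, where the implied constant may depend on $r$. In particular, for each fixed $r$, $\mathrm{fw}(u)$ can be computed in time $O(n^{\alpha_r})$ where $\alpha_r$ is a constant depending only on $r$.
   Context: Sequences are finite words over an alphabet of letters. Two sequences are isomorphic if one is obtained from the other by a one-to-one renaming of letters. A sequence $v$ contains a sequence $u$ if some (not necessarily contiguous) subsequence of $v$ is isomorphic to $u$. An $(r,s)$-formation is a concatenation of $s$ permutations of $r$ distinct letters (the same $r$ letters in each permutation). The formation width $\mathrm{fw}(u)$ is the minimum $s$ for which there exists an integer $r'$ such that every $(r',s)$-formation contains $u$. *)

theory Defs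
  imports Complex_Main "HOL-Library.Sublist" "HOL-Library.Landau_Symbols"
    "HOL-Combinatorics.Multiset_Permutations"
begin

section \<open>Formation width\<close>

definition isomorphic :: "'a list \<Rightarrow> 'b list \<Rightarrow> bool" where
  "isomorphic u v \<longleftrightarrow> (\<exists>f. inj_on f (set u) \<and> v = map f u)"

definition contains :: "'b list \<Rightarrow> 'a list \<Rightarrow> bool" where
  "contains v u \<longleftrightarrow> (\<exists>w. subseq w v \<and> isomorphic u w)"

definition is_formation :: "nat \<Rightarrow> nat \<Rightarrow> 'a list \<Rightarrow> bool" where
  "is_formation r s v \<longleftrightarrow>
     (\<exists>A ps. finite A \<and> card A = r \<and> length ps = s \<and>
             set ps \<subseteq> permutations_of_set A \<and> v = concat ps)"

text \<open>
  Formations are taken over the infinite alphabet \<^typ>\<open>nat\<close>: over a finite alphabet there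
  would be no formation at all for large \<open>r'\<close>, and the inner condition would hold vacuously.
\<close>

definition fw :: "'a list \<Rightarrow> nat" where
  "fw u = (LEAST s. \<exists>r'. \<forall>v :: nat list. is_formation r' s v \<longrightarrow> contains v u)"


section \<open>Random access machines with uniform cost\<close>

text \<open>
  The machine model is the classical random access machine (Cook and Reckhow): a finite program
  over registers and an unbounded directly addressable memory holding natural numbers, where
  every instruction costs one unit of time.  The only arithmetic is addition and (truncated)
  subtraction; there is no multiplication, with which uniform cost would be unrealistic.
  Registers are separate from the memory, so the input does not overlap the work registers.
\<close>

datatype instr =
    Const nat nat      \<comment> \<open>\<open>R\<^sub>i := c\<close>\<close>
  | Add nat nat nat    \<comment> \<open>\<open>R\<^sub>i := R\<^sub>j + R\<^sub>k\<close>\<close>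
  | Sub nat nat nat    \<comment> \<open>\<open>R\<^sub>i := R\<^sub>j - R\<^sub>k\<close>, truncated at \<open>0\<close>\<close>
  | Load nat nat       \<comment> \<open>\<open>R\<^sub>i := M[R\<^sub>j]\<close>\<close>
  | Store nat nat      \<comment> \<open>\<open>M[R\<^sub>i] := R\<^sub>j\<close>\<close>
  | JumpPos nat nat    \<comment> \<open>go to instruction \<open>l\<close> if \<open>R\<^sub>i > 0\<close>\<close>

type_synonym program = "instr list"

record config =
  pc :: nat
  reg :: "nat \<Rightarrow> nat"
  mem :: "nat \<Rightarrow> nat"

fun exec :: "instr \<Rightarrow> config \<Rightarrow> config" where
  "exec (Const i c) \<sigma> = \<sigma>\<lparr>pc := pc \<sigma> + 1, reg := (reg \<sigma>)(i := c)\<rparr>"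
| "exec (Add i j k) \<sigma> = \<sigma>\<lparr>pc := pc \<sigma> + 1, reg := (reg \<sigma>)(i := reg \<sigma> j + reg \<sigma> k)\<rparr>"
| "exec (Sub i j k) \<sigma> = \<sigma>\<lparr>pc := pc \<sigma> + 1, reg := (reg \<sigma>)(i := reg \<sigma> j - reg \<sigma> k)\<rparr>"
| "exec (Load i j) \<sigma> = \<sigma>\<lparr>pc := pc \<sigma> + 1, reg := (reg \<sigma>)(i := mem \<sigma> (reg \<sigma> j))\<rparr>"
| "exec (Store i j) \<sigma> = \<sigma>\<lparr>pc := pc \<sigma> + 1, mem := (mem \<sigma>)(reg \<sigma> i := reg \<sigma> j)\<rparr>"
| "exec (JumpPos i l) \<sigma> = \<sigma>\<lparr>pc := (if reg \<sigma> i > 0 then l else pc \<sigma> + 1)\<rparr>"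

definition halted :: "program \<Rightarrow> config \<Rightarrow> bool" where
  "halted P \<sigma> \<longleftrightarrow> pc \<sigma> \<ge> length P"

definition step :: "program \<Rightarrow> config \<Rightarrow> config" where
  "step P \<sigma> = (if halted P \<sigma> then \<sigma> else exec (P ! pc \<sigma>) \<sigma>)"

text \<open>
  The input \<open>u\<close> occupies the memory cells \<open>0, \<dots>, length u - 1\<close> (one letter, an arbitrary natural
  number, per cell) and its length is in register \<open>0\<close>; everything else is \<open>0\<close>.
\<close>

definition initial :: "nat list \<Rightarrow> config" where
  "initial u = \<lparr>pc = 0, reg = (\<lambda>i. if i = 0 then length u else 0),
                mem = (\<lambda>a. if a < length u then u ! a else 0)\<rparr>"

definition halts_within :: "program \<Rightarrow> nat list \<Rightarrow> nat \<Rightarrow> nat \<Rightarrow> bool" where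
  "halts_within P u t y \<longleftrightarrow>
     (\<exists>k\<le>t. let \<sigma> = (step P ^^ k) (initial u) in halted P \<sigma> \<and> reg \<sigma> 0 = y)"

text \<open>
  On every input from \<open>D\<close>, the program \<open>P\<close> computes the value of \<open>f\<close>, with worst-case run time
  (as a function of the input length) in \<open>O(g)\<close>.
\<close>

definition computes_in_time ::
  "program \<Rightarrow> nat list set \<Rightarrow> (nat list \<Rightarrow> nat) \<Rightarrow> (nat \<Rightarrow> real) \<Rightarrow> bool" where
  "computes_in_time P D f g \<longleftrightarrow>
     (\<exists>T :: nat \<Rightarrow> nat. (\<lambda>n. real (T n)) \<in> O(g) \<and>
        (\<forall>u\<in>D. halts_within P u (T (length u)) (f u)))"

end

theory Submission
  imports Defs "HOL-Library.Ramsey"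
begin

text \<open>
  Ramsey's theorem, applied to the pairs of letters that two permutations order alike, shows that a
  formation on enough letters contains a binary one, in which every permutation is a fixed one or
  its reverse.  Hence \<open>fw u\<close> is the least \<open>s\<close> such that for every sign pattern of length \<open>s\<close> some
  permutation \<open>w\<close> of the letters of \<open>u\<close> has \<open>u\<close> as a subsequence of the corresponding product of
  copies of \<open>w\<close> and its reverse.  Read such a product block by block and record, for each of the
  \<open>r!\<close> permutations, how many letters of \<open>u\<close> the greedy matching has consumed.  The number of
  further blocks needed in the worst case depends only on this state, one of \<open>(n + 1)\<^sup>r\<^sup>!\<close>
  vectors, and is one more than the maximum over the two successor states.  Every block increases
  all coordinates, so a table of these values is filled in decreasing order of the states, at
  constant cost per state.
\<close>

section \<open>Binary formations\<close>

definition orient :: "bool \<Rightarrow> 'a list \<Rightarrow> 'a list" where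
  "orient b w = (if b then rev w else w)"

definition binary_formation :: "bool list \<Rightarrow> 'a list \<Rightarrow> 'a list" where
  "binary_formation bs w = concat (map (\<lambda>b. orient b w) bs)"

lemma set_orient [simp]: "set (orient b w) = set w"
  by (simp add: orient_def)

lemma map_orient: "map f (orient b w) = orient b (map f w)"
  by (simp add: orient_def rev_map)

lemma filter_orient: "filter P (orient b w) = orient b (filter P w)"
  by (simp add: orient_def rev_filter)

lemma binary_formation_simps [simp]:
  "binary_formation [] w = []"
  "binary_formation (b # bs) w = orient b w @ binary_formation bs w"
  by (simp_all add: binary_formation_def)

lemma map_binary_formation: "map f (binary_formation bs w) = binary_formation bs (map f w)"
  by (induction bs) (simp_all add: map_orient)

lemma filter_binary_formation:
  "filter P (binary_formation bs w) = binary_formation bs (filter P w)"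
  by (induction bs) (simp_all add: filter_orient)

lemma set_binary_formation_subset: "set (binary_formation bs w) \<subseteq> set w"
  by (induction bs) auto

lemma binary_formation_is_formation:
  assumes "w \<in> permutations_of_set A" "finite A"
  shows "is_formation (card A) (length bs) (binary_formation bs w)"
  unfolding is_formation_def binary_formation_def
  using assms
  by (intro exI[of _ A] exI[of _ "map (\<lambda>b. orient b w) bs"])
     (auto simp: orient_def permutations_of_set_def)

section \<open>Two-letter subsequences and the order of letters in a word\<close>

lemma subseq_imp_set_subset: "subseq xs ys \<Longrightarrow> set xs \<subseteq> set ys"
  by (induction rule: list_emb.induct) auto

lemma subseq_doubleton_Cons:
  "subseq [x, y] (z # zs) \<longleftrightarrow> x = z \<and> y \<in> set zs \<or> subseq [x, y] zs"
  using subseq_imp_set_subset[of "[x, y]" zs] by (auto simp: subseq_singleton_left)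

text \<open>Reduces sortedness to pairs of letters, the form in which a two-colouring of pairs can
  supply it.\<close>

lemma sorted_wrt_iff_subseq:
  "sorted_wrt P xs \<longleftrightarrow> (\<forall>x y. subseq [x, y] xs \<longrightarrow> P x y)"
  by (induction xs) (auto simp: subseq_doubleton_Cons simp del: subseq_Cons2_iff)

lemma not_subseq_swap:
  assumes "distinct xs" "subseq [x, y] xs"
  shows "\<not> subseq [y, x] xs"
  using assms by (induction xs) (auto simp: subseq_doubleton_Cons simp del: subseq_Cons2_iff dest: subseq_imp_set_subset)

text \<open>Colour a pair of letters by whether \<open>p\<close> lists the smaller one first; on a
  homogeneous set \<open>p\<close> is increasing or decreasing. Only the existence of
  \<open>N\<close> matters later, so Ramsey's theorem serves in place of the sharp quadratic
  bound.\<close>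

lemma erdos_szekeres:
  "\<exists>N. \<forall>(A :: nat set) p. finite A \<and> card A \<ge> N \<and> p \<in> permutations_of_set A \<longrightarrow>
     (\<exists>S\<subseteq>A. card S = r \<and>
        (\<exists>b. filter (\<lambda>x. x \<in> S) p = orient b (sorted_list_of_set S)))"
proof -
  obtain N where N: "\<And>(V :: nat set) E. finite V \<Longrightarrow> card V \<ge> N \<Longrightarrow>
      \<exists>R\<subseteq>V. card R = r \<and> clique R E \<or> card R = r \<and> indep R E"
    using ramsey2[of r r] by blast
  have "\<exists>S\<subseteq>A. card S = r \<and> (\<exists>b. filter (\<lambda>x. x \<in> S) p = orient b (sorted_list_of_set S))"
    if A: "finite A" "card A \<ge> N" "p \<in> permutations_of_set A" for A :: "nat set" and p
  proof -
    define E where "E = {{x, y} | x y. x < y \<and> subseq [x, y] p}"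
    obtain S where S: "S \<subseteq> A" "card S = r" "clique S E \<or> indep S E"
      using N[OF A(1,2), of E] by blast
    define q where "q = filter (\<lambda>x. x \<in> S) p"
    have p: "set p = A" "distinct p" using A(3) by (auto simp: permutations_of_set_def)
    then have q: "set q = S" "distinct q" using S by (auto simp: q_def)
    have sub: "x \<noteq> y \<and> subseq [x, y] p \<and> x \<in> S \<and> y \<in> S" if "subseq [x, y] q" for x y
    proof -
      have "subseq [x, y] p" using that subseq_filter_left subseq_order.trans unfolding q_def by blast
      \<comment> \<open>For \<open>x = y\<close> the swapped pair would be the pair itself, which
        \<open>not_subseq_swap\<close> excludes.\<close>
      moreover have "x \<noteq> y" using not_subseq_swap[OF q(2) that] that by auto
      moreover have "x \<in> S" "y \<in> S" using subseq_imp_set_subset[OF that] q(1) by auto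
      ultimately show ?thesis by simp
    qed
    show ?thesis
    proof (cases "clique S E")
      case True
      have "sorted_wrt (<) q"
        unfolding sorted_wrt_iff_subseq
      proof (intro allI impI)
        fix x y assume xy: "subseq [x, y] q"
        then have "{x, y} \<in> E" using sub[OF xy] True unfolding clique_def by blast
        \<comment> \<open>Membership in \<open>E\<close> only says that the smaller of the two
          letters comes first; as \<open>p\<close> is distinct, that letter cannot be
          \<open>y\<close>.\<close>
        then show "x < y" using sub[OF xy] not_subseq_swap[OF p(2), of x y]
          by (auto simp: E_def doubleton_eq_iff)
      qed
      then have "sorted_list_of_set (set q) = q"
        by (simp add: sorted_list_of_set.idem_if_sorted_distinct strict_sorted_iff)
      then have "q = orient False (sorted_list_of_set S)"
        using q by (simp add: orient_def)
      then show ?thesis using S unfolding q_def by blast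
    next
      case False
      have "sorted_wrt (>) q"
        unfolding sorted_wrt_iff_subseq
      proof (intro allI impI)
        fix x y assume xy: "subseq [x, y] q"
        then have "{x, y} \<notin> E" using sub[OF xy] False S unfolding indep_def by blast
        moreover have "{x, y} \<in> E" if "x < y" using that sub[OF xy] unfolding E_def by blast
        ultimately show "y < x" using sub[OF xy] by (meson linorder_neqE_nat)
      qed
      then have "sorted_wrt (<) (rev q)" by (simp add: sorted_wrt_rev)
      then have "rev q = sorted_list_of_set (set (rev q))"
        by (metis sorted_list_of_set.idem_if_sorted_distinct strict_sorted_iff)
      then have "q = orient True (sorted_list_of_set S)"
        using q by (simp add: orient_def) (metis rev_rev_ident)
      then show ?thesis using S unfolding q_def by blast
    qed
  qed
  then show ?thesis by blast
qed

text \<open>Induction on the number of blocks. The first block is made monotone on a set large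
  enough for the induction hypothesis, which then handles the other blocks restricted to that set.
  Shrinking the set further keeps the first block monotone.\<close>

lemma formation_contains_binary_formation:
  "\<exists>N. \<forall>(A :: nat set) ps. finite A \<and> card A \<ge> N \<and> length ps = s \<and> set ps \<subseteq> permutations_of_set A \<longrightarrow>
     (\<exists>S\<subseteq>A. card S = r \<and>
        (\<exists>bs. length bs = s \<and>
          filter (\<lambda>x. x \<in> S) (concat ps) = binary_formation bs (sorted_list_of_set S)))"
proof (induction s)
  case 0
  have "\<exists>S\<subseteq>A. card S = r" if "card A \<ge> r" for A :: "nat set"
    using that by (metis obtain_subset_with_card_n)
  then show ?case by (intro exI[of _ r]) auto
next
  case (Suc s)
  then obtain N where N: "\<forall>(A :: nat set) ps. finite A \<and> card A \<ge> N \<and> length ps = s \<and> set ps \<subseteq> permutations_of_set A \<longrightarrow>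
     (\<exists>S\<subseteq>A. card S = r \<and>
        (\<exists>bs. length bs = s \<and>
          filter (\<lambda>x. x \<in> S) (concat ps) = binary_formation bs (sorted_list_of_set S)))" ..
  obtain N' where N': "\<forall>(A :: nat set) p. finite A \<and> card A \<ge> N' \<and> p \<in> permutations_of_set A \<longrightarrow>
     (\<exists>S\<subseteq>A. card S = N \<and>
        (\<exists>b. filter (\<lambda>x. x \<in> S) p = orient b (sorted_list_of_set S)))"
    using erdos_szekeres[of N] ..
  have "\<exists>S\<subseteq>A. card S = r \<and> (\<exists>bs. length bs = Suc s \<and>
          filter (\<lambda>x. x \<in> S) (concat ps) = binary_formation bs (sorted_list_of_set S))"
    if A: "finite A" "card A \<ge> N'" "length ps = Suc s" "set ps \<subseteq> permutations_of_set A"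
    for A :: "nat set" and ps
  proof -
    obtain p qs where ps: "ps = p # qs" using A(3) by (cases ps) auto
    obtain S b where S: "S \<subseteq> A" "card S = N" "filter (\<lambda>x. x \<in> S) p = orient b (sorted_list_of_set S)"
      using N'[rule_format, of A p] A ps by auto
    let ?qs = "map (filter (\<lambda>x. x \<in> S)) qs"
    have fS: "finite S" using S(1) A(1) finite_subset by blast
    have "set ?qs \<subseteq> permutations_of_set S"
    proof -
      have "set x = A \<and> distinct x" if "x \<in> set qs" for x
        using that A(4) ps by (auto simp: permutations_of_set_def)
      then show ?thesis using S(1) by (auto simp: permutations_of_set_def)
    qed
    then obtain S' bs where S': "S' \<subseteq> S" "card S' = r" "length bs = s"
      "filter (\<lambda>x. x \<in> S') (concat ?qs) = binary_formation bs (sorted_list_of_set S')"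
      using N[rule_format, of S ?qs] fS S(2) A(3) ps by auto
    have shrink: "filter (\<lambda>x. x \<in> S') (filter (\<lambda>x. x \<in> S) xs) = filter (\<lambda>x. x \<in> S') xs" for xs
      using S'(1) by (auto simp: filter_filter intro!: filter_cong)
    \<comment> \<open>Deleting letters keeps a list sorted, so the reference permutation of
      \<open>S'\<close> is cut out of that of \<open>S\<close>.\<close>
    have "sorted_list_of_set (set (filter (\<lambda>x. x \<in> S') (sorted_list_of_set S)))
        = filter (\<lambda>x. x \<in> S') (sorted_list_of_set S)"
      by (rule sorted_list_of_set.idem_if_sorted_distinct) (simp_all add: sorted_wrt_filter)
    moreover have "set (filter (\<lambda>x. x \<in> S') (sorted_list_of_set S)) = S'"
      using S'(1) fS by auto
    ultimately have "filter (\<lambda>x. x \<in> S') (sorted_list_of_set S) = sorted_list_of_set S'"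
      by simp
    then have "filter (\<lambda>x. x \<in> S') p = orient b (sorted_list_of_set S')"
      using shrink[of p] S(3) by (simp add: filter_orient)
    moreover have "filter (\<lambda>x. x \<in> S') (concat qs) = binary_formation bs (sorted_list_of_set S')"
      using shrink[of "concat qs"] S'(4) by (simp add: filter_concat)
    ultimately show ?thesis
      using S' S(1) ps by (intro exI[of _ S'] conjI exI[of _ "b # bs"]) auto
  qed
  then show ?case by blast
qed

section \<open>Reduction of the formation width to sign patterns\<close>

lemma distinct_lists_renaming:
  assumes "distinct xs" "distinct ys" "length xs = length ys"
  shows "\<exists>f. inj_on f (set xs) \<and> map f xs = ys"
proof -
  let ?f = "\<lambda>x. the (map_of (zip xs ys) x)"
  have "map ?f xs = ys"
    using assms by (intro nth_equalityI) (simp_all add: map_of_zip_nth)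
  moreover from this have "inj_on ?f (set xs)"
    using assms by (metis distinct_map)
  ultimately show ?thesis by blast
qed

text \<open>Eliminates \<open>r'\<close>. From left to right, binary formations are particular
  formations. From right to left, a threshold \<open>N\<close> for \<open>card (set u)\<close>
  letters serves as \<open>r'\<close>: every formation on \<open>N\<close> letters contains a binary
  one, into which the word found for its sign pattern can be renamed.\<close>

lemma formations_contain_iff:
  fixes u :: "'a list"
  shows "(\<exists>r'. \<forall>v :: nat list. is_formation r' s v \<longrightarrow> contains v u) \<longleftrightarrow>
    (\<forall>bs. length bs = s \<longrightarrow>
      (\<exists>w\<in>permutations_of_set (set u). subseq u (binary_formation bs w)))"
    (is "?L \<longleftrightarrow> ?R")
proof
  assume ?L
  then obtain r' where r': "\<And>v :: nat list. is_formation r' s v \<Longrightarrow> contains v u" by blast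
  show ?R
  proof (intro allI impI)
    fix bs :: "bool list" assume "length bs = s"
    have "[0..<r'] \<in> permutations_of_set {..<r'}" by (auto simp: permutations_of_set_def)
    then have "is_formation r' s (binary_formation bs [0..<r'])"
      using binary_formation_is_formation[of "[0..<r']" "{..<r'}" bs] \<open>length bs = s\<close> by simp
    then obtain f where f: "subseq (map f u) (binary_formation bs [0..<r'])" "inj_on f (set u)"
      using r' unfolding contains_def isomorphic_def by blast
    \<comment> \<open>Deleting the letters outside the copy of \<open>u\<close> and undoing the
      renaming turns \<open>[0..<r']\<close> into the required permutation of
      \<open>set u\<close>.\<close>
    define g x where "g = inv_into (set u) f" and "x = filter (\<lambda>y. y \<in> f ` set u) [0..<r']"
    have "set (map f u) \<subseteq> {..<r'}"
      using subset_trans[OF subseq_imp_set_subset[OF f(1)] set_binary_formation_subset] by auto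
    then have x: "set x = f ` set u" "distinct x" unfolding x_def by auto
    have "filter (\<lambda>y. y \<in> f ` set u) (map f u) = map f u" by (simp add: filter_id_conv)
    then have "subseq (map f u) (binary_formation bs x)"
      using subseq_filter[OF f(1), of "\<lambda>y. y \<in> f ` set u"]
      by (simp only: filter_binary_formation x_def)
    then have "subseq (map g (map f u)) (binary_formation bs (map g x))"
      by (metis subseq_map map_binary_formation)
    moreover have "map g (map f u) = u" using f(2) by (simp add: g_def map_idI)
    moreover have "map g x \<in> permutations_of_set (set u)"
    proof -
      have "inj_on g (set x)" using x f(2) by (simp add: g_def inj_on_inv_into)
      moreover have "g ` set x = set u" using x f(2) by (simp add: g_def image_comp)
      ultimately show ?thesis using x by (simp add: permutations_of_set_def distinct_map)
    qed
    ultimately show "\<exists>w\<in>permutations_of_set (set u). subseq u (binary_formation bs w)" by auto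
  qed
next
  assume R: ?R
  obtain N where N: "\<forall>(A :: nat set) ps. finite A \<and> card A \<ge> N \<and> length ps = s \<and> set ps \<subseteq> permutations_of_set A \<longrightarrow>
     (\<exists>S\<subseteq>A. card S = card (set u) \<and>
        (\<exists>bs. length bs = s \<and>
          filter (\<lambda>x. x \<in> S) (concat ps) = binary_formation bs (sorted_list_of_set S)))"
    using formation_contains_binary_formation[where s = s and r = "card (set u)"] ..
  have "contains v u" if v: "is_formation N s v" for v :: "nat list"
  proof -
    obtain A ps where "finite A" "card A = N" "length ps = s"
      "set ps \<subseteq> permutations_of_set A" "v = concat ps"
      using v unfolding is_formation_def by blast
    then obtain S bs where S: "card S = card (set u)" "length bs = s"
      "filter (\<lambda>x. x \<in> S) v = binary_formation bs (sorted_list_of_set S)"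
      using N[rule_format, of A ps] by auto
    then obtain w where w: "w \<in> permutations_of_set (set u)" "subseq u (binary_formation bs w)"
      using R by blast
    then obtain f where f: "inj_on f (set w)" "map f w = sorted_list_of_set S"
      using distinct_lists_renaming[of w "sorted_list_of_set S"] S(1)
      by (auto simp: permutations_of_set_def distinct_card[symmetric])
    have "subseq (map f u) (filter (\<lambda>x. x \<in> S) v)"
      using subseq_map[OF w(2), of f] by (simp add: map_binary_formation f S)
    then have "subseq (map f u) v"
      using subseq_filter_left subseq_order.trans by blast
    then show ?thesis
      using f(1) w(1) unfolding contains_def isomorphic_def by (auto simp: permutations_of_set_def)
  qed
  then show ?L by blast
qed


section \<open>Greedy matching and the recursion for the formation width\<close>

text \<open>Greedy matching: \<open>p\<close> letters of \<open>u\<close> are consumed before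
  \<open>w\<close> is read, and the result is the total consumed afterwards.\<close>

definition advance :: "'a list \<Rightarrow> 'a list \<Rightarrow> nat \<Rightarrow> nat" where
  "advance u w p = fold (\<lambda>x p. if p < length u \<and> u ! p = x then Suc p else p) w p"

lemma advance_Nil [simp]: "advance u [] p = p"
  and advance_Cons [simp]:
    "advance u (x # w) p = advance u w (if p < length u \<and> u ! p = x then Suc p else p)"
  and advance_append [simp]: "advance u (v @ w) p = advance u w (advance u v p)"
  by (simp_all add: advance_def)

lemma advance_ge: "p \<le> advance u w p"
proof (induction w arbitrary: p)
  case (Cons x w)
  show ?case using Cons[of p] Cons[of "Suc p"] by simp
qed simp

lemma advance_le: "p \<le> length u \<Longrightarrow> advance u w p \<le> length u"
  by (induction w arbitrary: p) auto

lemma advance_length [simp]: "advance u w (length u) = length u"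
  by (induction w) auto

lemma advance_gt: "p < length u \<Longrightarrow> u ! p \<in> set w \<Longrightarrow> p < advance u w p"
proof (induction w)
  case (Cons x w)
  then show ?case using advance_ge[of "Suc p" u w] by auto
qed simp

text \<open>Greedy matching is optimal because an embedding may always match equal heads. A single
  counter therefore decides containment.\<close>

lemma subseq_drop_iff_advance:
  "p \<le> length u \<Longrightarrow> subseq (drop p u) w \<longleftrightarrow> advance u w p = length u"
proof (induction w arbitrary: p)
  case (Cons x w)
  show ?case
  proof (cases "p < length u")
    case True
    then have "drop p u = u ! p # drop (Suc p) u" by (simp add: Cons_nth_drop_Suc)
    then show ?thesis using Cons.IH[of p] Cons.IH[of "Suc p"] True by auto
  qed (use Cons.prems in simp)
next
  case Nil
  have "subseq (drop p u) [] \<longleftrightarrow> drop p u = []" by (cases "drop p u") simp_all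
  then show ?case using Nil by auto
qed

text \<open>A state \<open>p\<close> records for each index \<open>k\<close> how much of
  \<open>u\<close> has been matched against the copies of \<open>W k\<close>; one block with sign
  \<open>b\<close> acts on all coordinates at once.\<close>

definition move :: "'a list \<Rightarrow> (nat \<Rightarrow> 'a list) \<Rightarrow> bool \<Rightarrow> (nat \<Rightarrow> nat) \<Rightarrow> nat \<Rightarrow> nat" where
  "move u W b p = (\<lambda>k. advance u (orient b (W k)) (p k))"

text \<open>An adversary chooses all \<open>s\<close> signs before the index \<open>k\<close> is
  chosen, so the universal quantifiers precede the existential one.\<close>

primrec covered :: "'a list \<Rightarrow> (nat \<Rightarrow> 'a list) \<Rightarrow> nat \<Rightarrow> nat \<Rightarrow> (nat \<Rightarrow> nat) \<Rightarrow> bool" where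
  "covered u W m 0 p \<longleftrightarrow> (\<exists>k<m. p k = length u)"
| "covered u W m (Suc s) p \<longleftrightarrow> (\<forall>b. covered u W m s (move u W b p))"

definition remaining :: "'a list \<Rightarrow> (nat \<Rightarrow> 'a list) \<Rightarrow> nat \<Rightarrow> (nat \<Rightarrow> nat) \<Rightarrow> nat" where
  "remaining u W m p = (LEAST s. covered u W m s p)"

lemma covered_iff:
  "covered u W m s p \<longleftrightarrow>
    (\<forall>bs. length bs = s \<longrightarrow> (\<exists>k<m. advance u (binary_formation bs (W k)) (p k) = length u))"
proof (induction s arbitrary: p)
  case (Suc s)
  have "(\<forall>bs. length bs = Suc s \<longrightarrow> Q bs) \<longleftrightarrow> (\<forall>b bs. length bs = s \<longrightarrow> Q (b # bs))" for Q
    by (metis length_Suc_conv)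
  from this[of "\<lambda>bs. \<exists>k<m. advance u (binary_formation bs (W k)) (p k) = length u"]
  show ?case using Suc.IH by (simp add: move_def)
qed simp

lemma covered_cong:
  "(\<And>k. k < m \<Longrightarrow> p k = q k) \<Longrightarrow> covered u W m s p \<longleftrightarrow> covered u W m s q"
proof -
  assume "\<And>k. k < m \<Longrightarrow> p k = q k"
  then have "(\<exists>k<m. advance u (binary_formation bs (W k)) (p k) = length u) \<longleftrightarrow>
      (\<exists>k<m. advance u (binary_formation bs (W k)) (q k) = length u)" for bs by auto
  then show ?thesis unfolding covered_iff by (simp only:)
qed

text \<open>States are functions on all naturals although only the coordinates below
  \<open>m\<close> count. This lets a table entry be identified by its code alone.\<close>

lemma remaining_cong:
  assumes "\<And>k. k < m \<Longrightarrow> p k = q k"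
  shows "remaining u W m p = remaining u W m q"
proof -
  have "covered u W m s p = covered u W m s q" for s by (rule covered_cong) (rule assms)
  then show ?thesis by (simp only: remaining_def)
qed

lemma covered_Suc: "covered u W m s p \<Longrightarrow> covered u W m (Suc s) p"
proof (induction s arbitrary: p)
  case 0
  then show ?case by (auto simp: move_def intro!: exI)
next
  case (Suc s)
  then have "covered u W m (Suc s) (move u W b p)" for b by simp
  then show ?case by (subst covered.simps) (rule allI)
qed

lemma covered_mono: "covered u W m s p \<Longrightarrow> s \<le> t \<Longrightarrow> covered u W m t p"
proof (induction t)
  case (Suc t)
  show ?case
  proof (cases "s = Suc t")
    case False
    then have "covered u W m t p" using Suc by simp
    then show ?thesis by (rule covered_Suc)
  qed (use Suc.prems in simp)
qed simp

lemma remaining_0: "\<exists>k<m. p k = length u \<Longrightarrow> remaining u W m p = 0"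
  unfolding remaining_def by (rule Least_eq_0) simp

lemma move_le: "p k \<le> length u \<Longrightarrow> move u W b p k \<le> length u"
  by (simp add: move_def advance_le)

context
  fixes u :: "'a list" and W :: "nat \<Rightarrow> 'a list" and m :: nat
  assumes set_W: "\<And>k. k < m \<Longrightarrow> set (W k) = set u" and m_pos: "0 < m"
begin

lemma move_gt: "k < m \<Longrightarrow> p k < length u \<Longrightarrow> p k < move u W b p k"
  by (simp add: move_def advance_gt set_W)

text \<open>Each block contains every letter of \<open>u\<close> and hence consumes at least one
  more letter. This provides the witness that makes the least number in \<open>remaining\<close>
  meaningful.\<close>

lemma covered_if_long:
  assumes "k < m" "p k \<le> length u" "length u \<le> p k + s"
  shows "covered u W m s p"
  using assms(2,3)
proof (induction s arbitrary: p)
  case 0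
  then show ?case using assms(1) by auto
next
  case (Suc s)
  have "covered u W m s (move u W b p)" for b
  proof (rule Suc.IH)
    show "move u W b p k \<le> length u" using Suc.prems by (simp add: move_le)
    show "length u \<le> move u W b p k + s"
    proof (cases "p k = length u")
      case True
      then show ?thesis by (simp add: move_def)
    next
      case False
      then show ?thesis using move_gt[OF assms(1), of p b] Suc.prems by simp
    qed
  qed
  then show ?case by simp
qed

lemma covered_iff_remaining_le:
  assumes "\<And>k. k < m \<Longrightarrow> p k \<le> length u"
  shows "covered u W m s p \<longleftrightarrow> remaining u W m p \<le> s"
proof
  have "covered u W m (length u) p"
    using covered_if_long[of 0 p "length u"] m_pos assms by simp
  then have "covered u W m (remaining u W m p) p"
    unfolding remaining_def by (rule LeastI)
  then show "covered u W m s p" if "remaining u W m p \<le> s"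
    using that covered_mono by blast
  show "remaining u W m p \<le> s" if "covered u W m s p"
    using that unfolding remaining_def by (rule Least_le)
qed

text \<open>The adversary picks the worse sign. Equality is shown by comparing the upper bounds
  \<open>s\<close> of both sides, where \<open>covered\<close> unfolds directly.\<close>

lemma remaining_step:
  assumes "\<And>k. k < m \<Longrightarrow> p k < length u"
  shows "remaining u W m p =
    Suc (max (remaining u W m (move u W False p)) (remaining u W m (move u W True p)))"
proof -
  have le: "p k \<le> length u" "move u W b p k \<le> length u" if "k < m" for k b
    using assms[OF that] by (simp_all add: move_le)
  have "remaining u W m p \<le> s \<longleftrightarrow>
     Suc (max (remaining u W m (move u W False p)) (remaining u W m (move u W True p))) \<le> s" for s
  proof (cases s)
    case 0
    \<comment> \<open>No coordinate is complete, so at least one block is needed; this is the source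
      of the outer \<open>Suc\<close>.\<close>
    have "\<not> covered u W m 0 p" using assms by fastforce
    then show ?thesis using covered_iff_remaining_le[of p 0] le 0 by (simp del: covered.simps)
  next
    case (Suc t)
    have "remaining u W m p \<le> s \<longleftrightarrow> (\<forall>b. covered u W m t (move u W b p))"
      using covered_iff_remaining_le[of p s] le Suc by simp
    also have "\<dots> \<longleftrightarrow> (\<forall>b. remaining u W m (move u W b p) \<le> t)"
      using covered_iff_remaining_le le by simp
    finally show ?thesis using Suc by (auto simp: all_bool_eq)
  qed
  from this[of "remaining u W m p"] this[of "Suc (max (remaining u W m (move u W False p))
      (remaining u W m (move u W True p)))"]
  show ?thesis by linarith
qed

end

lemma fw_eq_remaining:
  assumes "W ` {..<m} = permutations_of_set (set u)"
  shows "fw u = remaining u W m (\<lambda>_. 0)"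
proof -
  have "(\<exists>w\<in>permutations_of_set (set u). subseq u (binary_formation bs w)) \<longleftrightarrow>
        (\<exists>k<m. advance u (binary_formation bs (W k)) 0 = length u)" for bs
    unfolding assms[symmetric] using subseq_drop_iff_advance[of 0 u] by (simp add: Bex_def)
  then show ?thesis
    unfolding fw_def remaining_def formations_contain_iff covered_iff by (simp only:)
qed


section \<open>Positional encoding of states\<close>

definition encode :: "nat \<Rightarrow> nat \<Rightarrow> (nat \<Rightarrow> nat) \<Rightarrow> nat" where
  "encode B m p = (\<Sum>k<m. p k * B ^ k)"

lemma encode_lt: "(\<And>k. k < m \<Longrightarrow> p k < B) \<Longrightarrow> encode B m p < B ^ m"
proof (induction m)
  case (Suc m)
  have "encode B m p < B ^ m" using Suc.IH[OF Suc.prems[OF less_SucI]] .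
  moreover have "(p m + 1) * B ^ m \<le> B * B ^ m" using Suc.prems[of m] by (intro mult_right_mono) auto
  ultimately show ?case by (simp add: encode_def)
qed (simp add: encode_def)

lemma encode_inj:
  assumes "\<And>k. k < m \<Longrightarrow> p k < B" "\<And>k. k < m \<Longrightarrow> q k < B" "encode B m p = encode B m q" "k < m"
  shows "p k = q k"
  using assms
proof (induction m)
  case (Suc m)
  have split: "encode B (Suc m) f = encode B m f + f m * B ^ m" for f by (simp add: encode_def)
  have lt: "encode B m p < B ^ m" "encode B m q < B ^ m" using Suc.prems by (simp_all add: encode_lt)
  then have "B ^ m > 0" by linarith
  \<comment> \<open>The lower digits contribute less than \<open>B ^ m\<close>, so division isolates
    the top digit.\<close>
  then have "p m = q m"
    using arg_cong[OF Suc.prems(3), of "\<lambda>x. x div B ^ m"] lt by (simp add: split)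
  moreover have "p k = q k" if "k < m"
  proof (rule Suc.IH[OF _ _ _ that])
    show "encode B m p = encode B m q" using Suc.prems(3) \<open>p m = q m\<close> by (simp add: split)
  qed (use Suc.prems(1,2) less_SucI in blast)+
  ultimately show ?case using Suc.prems(4) by (cases "k = m") simp_all
qed simp

text \<open>A block raises every unfinished coordinate, so the code of a successor is larger and its
  entry is already known when the table is filled downwards.\<close>

lemma encode_strict_mono: "m > 0 \<Longrightarrow> B > 0 \<Longrightarrow> (\<And>k. k < m \<Longrightarrow> p k < q k) \<Longrightarrow> encode B m p < encode B m q"
  unfolding encode_def by (intro sum_strict_mono) auto


section \<open>A structured language compiled to the machine\<close>

text \<open>
  Register \<open>0\<close> holds the input length \<open>n\<close> and register \<open>1\<close> the constant \<open>1\<close>; neither may be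
  assigned.  \<open>IfZ i c\<close> runs \<open>c\<close> if register \<open>i\<close> is \<open>0\<close>, and \<open>For i c\<close> runs \<open>c\<close> for
  \<open>i = n, n - 1, \<dots>, 0\<close>, so that the number of iterations is \<open>n + 1\<close> and every run time is a
  polynomial in \<open>n\<close> determined by the syntax.
\<close>

datatype com = Skip | Ins instr | Seq com com | IfZ nat com | For nat com

type_synonym store = "(nat \<Rightarrow> nat) \<times> (nat \<Rightarrow> nat)"

fun effect :: "instr \<Rightarrow> store \<Rightarrow> store" where
  "effect (Const i c) (R, M) = (R(i := c), M)"
| "effect (Add i j k) (R, M) = (R(i := R j + R k), M)"
| "effect (Sub i j k) (R, M) = (R(i := R j - R k), M)"
| "effect (Load i j) (R, M) = (R(i := M (R j)), M)"
| "effect (Store i j) (R, M) = (R, M(R i := R j))"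
| "effect (JumpPos i l) s = s"

text \<open>Index \<open>k - 1\<close> is processed first and \<open>0\<close> last, which suits a
  loop that stops when its counter is no longer positive.\<close>

primrec iter :: "(nat \<Rightarrow> 's \<Rightarrow> 's) \<Rightarrow> nat \<Rightarrow> 's \<Rightarrow> 's" where
  "iter f 0 s = s"
| "iter f (Suc k) s = iter f k (f k s)"

definition assign :: "nat \<Rightarrow> nat \<Rightarrow> store \<Rightarrow> store" where
  "assign i k s = ((fst s)(i := k), snd s)"

primrec sem :: "com \<Rightarrow> store \<Rightarrow> store" where
  "sem Skip s = s"
| "sem (Ins x) s = effect x s"
| "sem (Seq c d) s = sem d (sem c s)"
| "sem (IfZ i c) s = (if fst s i = 0 then sem c s else s)"
| "sem (For i c) s = iter (\<lambda>k s. sem c (assign i k s)) (Suc (fst s 0)) s"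

fun target :: "instr \<Rightarrow> nat set" where
  "target (Const i c) = {i}"
| "target (Add i j k) = {i}"
| "target (Sub i j k) = {i}"
| "target (Load i j) = {i}"
| "target (Store i j) = {}"
| "target (JumpPos i l) = {}"

primrec writes :: "com \<Rightarrow> nat set" where
  "writes Skip = {}"
| "writes (Ins x) = target x"
| "writes (Seq c d) = writes c \<union> writes d"
| "writes (IfZ i c) = writes c"
| "writes (For i c) = insert i (writes c)"

primrec storeless :: "com \<Rightarrow> bool" where
  "storeless Skip \<longleftrightarrow> True"
| "storeless (Ins x) \<longleftrightarrow> (\<nexists>i j. x = Store i j)"
| "storeless (Seq c d) \<longleftrightarrow> storeless c \<and> storeless d"
| "storeless (IfZ i c) \<longleftrightarrow> storeless c"
| "storeless (For i c) \<longleftrightarrow> storeless c"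

text \<open>Raw jumps are excluded so that only \<open>compile\<close> determines control flow.
  Protecting registers \<open>0\<close> and \<open>1\<close> and the loop counter fixes the number
  of iterations.\<close>

primrec well_formed :: "com \<Rightarrow> bool" where
  "well_formed Skip \<longleftrightarrow> True"
| "well_formed (Ins x) \<longleftrightarrow> (\<nexists>i l. x = JumpPos i l) \<and> target x \<inter> {0, 1} = {}"
| "well_formed (Seq c d) \<longleftrightarrow> well_formed c \<and> well_formed d"
| "well_formed (IfZ i c) \<longleftrightarrow> well_formed c"
| "well_formed (For i c) \<longleftrightarrow> well_formed c \<and> i \<notin> writes c \<and> i \<notin> {0, 1}"

primrec code_length :: "com \<Rightarrow> nat" where
  "code_length Skip = 0"
| "code_length (Ins x) = 1"
| "code_length (Seq c d) = code_length c + code_length d"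
| "code_length (IfZ i c) = code_length c + 1"
| "code_length (For i c) = code_length c + 3"

text \<open>Jump targets are absolute, hence the load address \<open>l\<close>. A counter starts at
  \<open>n + 1\<close> and is decremented before the body, so one positivity test at the end yields
  the values \<open>n, ..., 0\<close>.\<close>

primrec compile :: "com \<Rightarrow> nat \<Rightarrow> program" where
  "compile Skip l = []"
| "compile (Ins x) l = [x]"
| "compile (Seq c d) l = compile c l @ compile d (l + code_length c)"
| "compile (IfZ i c) l = JumpPos i (l + 1 + code_length c) # compile c (l + 1)"
| "compile (For i c) l = Add i 0 1 # Sub i i 1 # compile c (l + 2) @ [JumpPos i (l + 1)]"

text \<open>An upper bound read off the syntax: the body of a conditional is always charged, and
  each pass of a loop pays for the decrement and the jump.\<close>

primrec cost :: "nat \<Rightarrow> com \<Rightarrow> nat" where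
  "cost n Skip = 0"
| "cost n (Ins x) = 1"
| "cost n (Seq c d) = cost n c + cost n d"
| "cost n (IfZ i c) = 1 + cost n c"
| "cost n (For i c) = 1 + (n + 1) * (cost n c + 2)"

primrec depth :: "com \<Rightarrow> nat" where
  "depth Skip = 0"
| "depth (Ins x) = 0"
| "depth (Seq c d) = max (depth c) (depth d)"
| "depth (IfZ i c) = depth c"
| "depth (For i c) = Suc (depth c)"

lemma length_compile [simp]: "length (compile c l) = code_length c"
  by (induction c arbitrary: l) auto

text \<open>Only loops raise the degree. The base \<open>n + 1\<close> keeps every power at least
  \<open>1\<close>, so additive constants are absorbed even at \<open>n = 0\<close>.\<close>

lemma cost_polynomial: "\<exists>K. \<forall>n. cost n c \<le> K * (n + 1) ^ depth c"
proof (induction c)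
  case (Seq c d)
  then obtain K L where K: "\<And>n. cost n c \<le> K * (n + 1) ^ depth c" "\<And>n. cost n d \<le> L * (n + 1) ^ depth d"
    by blast
  have "cost n (Seq c d) \<le> (K + L) * (n + 1) ^ depth (Seq c d)" for n
  proof -
    have "K * (n + 1) ^ depth c \<le> K * (n + 1) ^ depth (Seq c d)"
      "L * (n + 1) ^ depth d \<le> L * (n + 1) ^ depth (Seq c d)"
      by (intro mult_left_mono power_increasing; simp)+
    then show ?thesis using K[of n] unfolding cost.simps add_mult_distrib by linarith
  qed
  then show ?case by blast
next
  case (IfZ i c)
  then obtain K where K: "\<And>n. cost n c \<le> K * (n + 1) ^ depth c" by blast
  have "cost n (IfZ i c) \<le> (K + 1) * (n + 1) ^ depth (IfZ i c)" for n
  proof -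
    have "1 \<le> (n + 1) ^ depth c" by simp
    then show ?thesis using K[of n] unfolding cost.simps depth.simps add_mult_distrib by linarith
  qed
  then show ?case by blast
next
  case (For i c)
  then obtain K where K: "\<And>n. cost n c \<le> K * (n + 1) ^ depth c" by blast
  have "cost n (For i c) \<le> (K + 3) * (n + 1) ^ depth (For i c)" for n
  proof -
    have 1: "1 \<le> (n + 1) ^ depth c" by simp
    have "cost n (For i c) \<le> (n + 1) * (cost n c + 3)" by (simp add: algebra_simps)
    also have "\<dots> \<le> (n + 1) * ((K + 3) * (n + 1) ^ depth c)"
    proof (rule mult_left_mono)
      show "cost n c + 3 \<le> (K + 3) * (n + 1) ^ depth c"
        using K[of n] 1 unfolding add_mult_distrib by linarith
    qed simp
    finally show ?thesis by (simp add: algebra_simps)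
  qed
  then show ?case by blast
next
  case (Ins x)
  then show ?case by (intro exI[of _ 1]) simp
qed simp

text \<open>The index of the invariant is the number of passes still to come, so it descends to
  \<open>0\<close>.\<close>

lemma iter_invariant:
  assumes "I K s" "\<And>k s. k < K \<Longrightarrow> I (Suc k) s \<Longrightarrow> I k (f k s)"
  shows "I 0 (iter f K s)"
  using assms
proof (induction K arbitrary: s)
  case (Suc K)
  have "I K (f K s)" by (rule Suc.prems(2)[OF _ Suc.prems(1)]) simp
  then have "I 0 (iter f K (f K s))" by (rule Suc.IH) (rule Suc.prems(2)[OF less_SucI])
  then show ?case by simp
qed simp

lemma iter_preserves:
  assumes "\<And>k s. h (f k s) = h s"
  shows "h (iter f K s) = h s"
  by (induction K arbitrary: s) (simp_all add: assms)

lemma fst_assign [simp]: "fst (assign i k s) = (fst s)(i := k)"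
  and snd_assign [simp]: "snd (assign i k s) = snd s"
  by (simp_all add: assign_def)

lemma sem_other_register: "x \<notin> writes c \<Longrightarrow> fst (sem c s) x = fst s x"
proof (induction c arbitrary: s)
  case (Ins i)
  then show ?case by (cases s; cases i) auto
next
  case (For i c)
  show ?case
    unfolding sem.simps by (rule iter_preserves[of "\<lambda>s. fst s x"]) (use For in simp)
qed auto

lemma sem_storeless: "storeless c \<Longrightarrow> snd (sem c s) = snd s"
proof (induction c arbitrary: s)
  case (Ins i)
  then show ?case by (cases s; cases i) auto
next
  case (For i c)
  show ?case
    unfolding sem.simps by (rule iter_preserves[of snd]) (use For in simp)
qed auto

lemma well_formed_writes: "well_formed c \<Longrightarrow> 0 \<notin> writes c \<and> 1 \<notin> writes c"
  by (induction c) auto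

section \<open>Correctness of the compiler\<close>

definition segment :: "program \<Rightarrow> nat \<Rightarrow> program \<Rightarrow> bool" where
  "segment P l xs \<longleftrightarrow> (\<exists>pre post. P = pre @ xs @ post \<and> length pre = l)"

lemma segment_append:
  assumes "segment P l (xs @ ys)"
  shows "segment P l xs" "segment P (l + length xs) ys"
proof -
  obtain pre post where P: "P = pre @ (xs @ ys) @ post" "length pre = l"
    using assms unfolding segment_def by blast
  show "segment P l xs"
    unfolding segment_def using P by (intro exI[of _ pre] exI[of _ "ys @ post"]) simp
  show "segment P (l + length xs) ys"
    unfolding segment_def using P by (intro exI[of _ "pre @ xs"] exI[of _ post]) simp
qed

lemma segment_Cons:
  assumes "segment P l (x # xs)"
  shows "l < length P" "P ! l = x" "segment P (l + 1) xs"
proof -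
  show "l < length P" "P ! l = x" using assms by (auto simp: segment_def)
  show "segment P (l + 1) xs" using segment_append(2)[of P l "[x]" xs] assms by simp
qed

definition config_at :: "nat \<Rightarrow> store \<Rightarrow> config" where
  "config_at l s = \<lparr>pc = l, reg = fst s, mem = snd s\<rparr>"

definition reaches :: "program \<Rightarrow> nat \<Rightarrow> config \<Rightarrow> config \<Rightarrow> bool" where
  "reaches P t \<sigma> \<tau> \<longleftrightarrow> (\<exists>k\<le>t. (step P ^^ k) \<sigma> = \<tau>)"

lemma reaches_refl: "reaches P t \<sigma> \<sigma>"
  unfolding reaches_def by (intro exI[of _ 0]) simp

lemma reaches_trans:
  assumes "reaches P t \<rho> \<sigma>" "reaches P t' \<sigma> \<tau>" "t + t' \<le> t''"
  shows "reaches P t'' \<rho> \<tau>"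
proof -
  obtain k k' where "k \<le> t" "(step P ^^ k) \<rho> = \<sigma>" "k' \<le> t'" "(step P ^^ k') \<sigma> = \<tau>"
    using assms(1,2) unfolding reaches_def by blast
  then show ?thesis
    unfolding reaches_def using assms(3) by (intro exI[of _ "k' + k"]) (simp add: funpow_add)
qed

lemma reaches_effect:
  assumes "segment P l (x # xs)" "\<nexists>i l. x = JumpPos i l"
  shows "reaches P 1 (config_at l s) (config_at (l + 1) (effect x s))"
proof -
  have "step P (config_at l s) = config_at (l + 1) (effect x s)"
    using segment_Cons[OF assms(1)] assms(2)
    by (cases s; cases x) (auto simp: step_def halted_def config_at_def)
  then show ?thesis unfolding reaches_def by (intro exI[of _ 1]) simp
qed

lemma reaches_jump:
  assumes "segment P l (JumpPos i l' # xs)"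
  shows "reaches P 1 (config_at l s) (config_at (if fst s i > 0 then l' else l + 1) s)"
proof -
  have "step P (config_at l s) = config_at (if fst s i > 0 then l' else l + 1) s"
    using segment_Cons[OF assms] by (simp add: step_def halted_def config_at_def)
  then show ?thesis unfolding reaches_def by (intro exI[of _ 1]) simp
qed

theorem compile_correct:
  assumes "well_formed c" "segment P l (compile c l)" "fst s 0 = n" "fst s 1 = 1"
  shows "reaches P (cost n c) (config_at l s) (config_at (l + code_length c) (sem c s))"
  using assms
proof (induction c arbitrary: l s)
  case Skip
  then show ?case by (simp add: reaches_refl)
next
  case (Ins x)
  then show ?case using reaches_effect[of P l x "[]" s] by simp
next
  case (Seq c d)
  have seg: "segment P l (compile c l)" "segment P (l + code_length c) (compile d (l + code_length c))"
    using segment_append[OF Seq.prems(2)[unfolded compile.simps]] by simp_all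
  have regs: "fst (sem c s) 0 = n" "fst (sem c s) 1 = 1"
    using Seq.prems sem_other_register well_formed_writes[of c] by simp_all
  show ?case
    using reaches_trans[OF Seq.IH(1)[OF _ seg(1)] Seq.IH(2)[OF _ seg(2) regs]] Seq.prems
    by (simp add: add.assoc)
next
  case (IfZ i c)
  note seg = segment_Cons[OF IfZ.prems(2)[unfolded compile.simps]]
  note jump = reaches_jump[OF IfZ.prems(2)[unfolded compile.simps], of s]
  show ?case
  proof (cases "fst s i = 0")
    case True
    have "reaches P (cost n c) (config_at (l + 1) s) (config_at (l + 1 + code_length c) (sem c s))"
      using IfZ.IH[OF _ seg(3) IfZ.prems(3,4)] IfZ.prems(1) by simp
    then show ?thesis using reaches_trans[OF jump] True by simp
  next
    case False
    then show ?thesis using reaches_trans[OF jump reaches_refl[of P 0]] by simp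
  qed
next
  case (For i c)
  have i: "i \<notin> writes c" "i \<noteq> 0" "i \<noteq> 1" and wf: "well_formed c" using For.prems by simp_all
  note seg0 = For.prems(2)[unfolded compile.simps]
  have seg1: "segment P (l + 1) (Sub i i 1 # compile c (l + 2) @ [JumpPos i (l + 1)])"
    using segment_Cons[OF seg0] by simp
  have seg2: "segment P (l + 2) (compile c (l + 2))"
    "segment P (l + 2 + code_length c) [JumpPos i (l + 1)]"
    using segment_append[of P "l + 2" "compile c (l + 2)"] segment_Cons[OF seg1] by simp_all
  let ?f = "\<lambda>k s. sem c (assign i k s)"
  \<comment> \<open>A pass begins at the decrement with counter \<open>Suc k\<close>, so the body
    sees \<open>k\<close>; the jump goes back precisely while \<open>k > 0\<close>.\<close>
  have iteration: "reaches P (cost n c + 2) (config_at (l + 1) (assign i (Suc k) s))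
      (config_at (if k > 0 then l + 1 else l + 3 + code_length c) (?f k s))"
    if s: "fst s 0 = n" "fst s 1 = 1" for k s
  proof -
    have "effect (Sub i i 1) (assign i (Suc k) s) = assign i k s"
      using s i by (simp add: assign_def)
    then have 1: "reaches P 1 (config_at (l + 1) (assign i (Suc k) s)) (config_at (l + 2) (assign i k s))"
      using reaches_effect[OF seg1, of "assign i (Suc k) s"] by simp
    have 2: "reaches P (cost n c) (config_at (l + 2) (assign i k s))
        (config_at (l + 2 + code_length c) (?f k s))"
      using For.IH[OF wf seg2(1), of "assign i k s"] s i by simp
    have 3: "reaches P 1 (config_at (l + 2 + code_length c) (?f k s))
        (config_at (if k > 0 then l + 1 else l + 3 + code_length c) (?f k s))"
      using reaches_jump[OF seg2(2), of "?f k s"] i by (cases k) (simp_all add: sem_other_register numeral_3_eq_3)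
    show ?thesis
      by (rule reaches_trans[OF reaches_trans[OF 1 2 order_refl] 3]) simp
  qed
  have loop: "reaches P (Suc k * (cost n c + 2)) (config_at (l + 1) (assign i (Suc k) s))
      (config_at (l + 3 + code_length c) (iter ?f (Suc k) s))"
    if "fst s 0 = n" "fst s 1 = 1" for k s
    using that
  proof (induction k arbitrary: s)
    case 0
    then show ?case using iteration[of s 0] by simp
  next
    case (Suc k)
    let ?s = "?f (Suc k) s"
    have regs: "fst ?s 0 = n" "fst ?s 1 = 1" "fst ?s i = Suc k"
      using Suc.prems i wf sem_other_register well_formed_writes[of c] by simp_all
    \<comment> \<open>\<open>iter\<close> assigns the counter anew in each pass whereas the machine
      only decrements it. Both agree because the body leaves the counter alone.\<close>
    then have "assign i (Suc k) ?s = ?s" by (simp add: assign_def fun_upd_idem prod_eq_iff)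
    then have rest: "reaches P (Suc k * (cost n c + 2)) (config_at (l + 1) ?s)
        (config_at (l + 3 + code_length c) (iter ?f (Suc k) ?s))"
      using Suc.IH[OF regs(1,2)] by simp
    have "reaches P (cost n c + 2) (config_at (l + 1) (assign i (Suc (Suc k)) s)) (config_at (l + 1) ?s)"
      using iteration[OF Suc.prems, of "Suc k"] by simp
    from reaches_trans[OF this rest order_refl] show ?case by (simp add: ac_simps)
  qed
  have "effect (Add i 0 1) s = assign i (Suc n) s"
    using For.prems by (cases s) (simp add: assign_def)
  then have "reaches P 1 (config_at l s) (config_at (l + 1) (assign i (Suc n) s))"
    using reaches_effect[OF seg0, of s] by simp
  from reaches_trans[OF this loop[OF For.prems(3,4), of n] order_refl]
  show ?case using For.prems(3) by (simp add: algebra_simps)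
qed


section \<open>The program\<close>

text \<open>
  Registers: \<open>ptr\<close> points into the table of values of \<^const>\<open>remaining\<close>, which is stored from
  address \<open>n\<close> on in the order of \<^const>\<open>encode\<close>; the three families of registers hold the distinct
  letters, the powers of \<open>n + 1\<close>, and the current state.
\<close>

abbreviation (input) ptr :: nat where "ptr \<equiv> 2"
abbreviation (input) pos :: nat where "pos \<equiv> 3"
abbreviation (input) addr :: nat where "addr \<equiv> 4"
abbreviation (input) letter :: nat where "letter \<equiv> 5"
abbreviation (input) diff :: nat where "diff \<equiv> 6"
abbreviation (input) tmp :: nat where "tmp \<equiv> 7"
abbreviation (input) flag :: nat where "flag \<equiv> 8"
abbreviation (input) val :: "bool \<Rightarrow> nat" where "val b \<equiv> (if b then 10 else 9)"
abbreviation (input) idx :: nat where "idx \<equiv> 11"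

definition letter_reg :: "nat \<Rightarrow> nat" where "letter_reg j = 3 * j + 20"
definition power_reg :: "nat \<Rightarrow> nat" where "power_reg k = 3 * k + 21"
definition digit_reg :: "nat \<Rightarrow> nat" where "digit_reg k = 3 * k + 22"

text \<open>The three families lie in different residue classes modulo \<open>3\<close>, so they can
  be arbitrarily long without collision.\<close>

lemma reg_eq [simp]:
  "letter_reg j = letter_reg k \<longleftrightarrow> j = k"
  "power_reg j = power_reg k \<longleftrightarrow> j = k"
  "digit_reg j = digit_reg k \<longleftrightarrow> j = k"
  "letter_reg j \<noteq> power_reg k" "power_reg k \<noteq> letter_reg j"
  "letter_reg j \<noteq> digit_reg k" "digit_reg k \<noteq> letter_reg j"
  "power_reg j \<noteq> digit_reg k" "digit_reg k \<noteq> power_reg j"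
  unfolding letter_reg_def power_reg_def digit_reg_def by presburger+

lemma reg_ge: "20 \<le> letter_reg j" "20 \<le> power_reg j" "20 \<le> digit_reg j"
  by (simp_all add: letter_reg_def power_reg_def digit_reg_def)

lemma reg_neq [simp]:
  "x < 20 \<Longrightarrow> letter_reg j \<noteq> x" "x < 20 \<Longrightarrow> x \<noteq> letter_reg j"
  "x < 20 \<Longrightarrow> power_reg j \<noteq> x" "x < 20 \<Longrightarrow> x \<noteq> power_reg j"
  "x < 20 \<Longrightarrow> digit_reg j \<noteq> x" "x < 20 \<Longrightarrow> x \<noteq> digit_reg j"
  using reg_ge[of j] by auto

definition seqs :: "com list \<Rightarrow> com" where
  "seqs cs = foldr Seq cs Skip"

lemma seqs_simps [simp]: "seqs [] = Skip" "seqs (c # cs) = Seq c (seqs cs)"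
  by (simp_all add: seqs_def)

lemma sem_seqs_append [simp]: "sem (seqs (cs @ ds)) s = sem (seqs ds) (sem (seqs cs) s)"
  by (induction cs arbitrary: s) auto

lemma writes_seqs [simp]: "writes (seqs cs) = (\<Union>c\<in>set cs. writes c)"
  by (induction cs) auto

lemma storeless_seqs [simp]: "storeless (seqs cs) \<longleftrightarrow> (\<forall>c\<in>set cs. storeless c)"
  by (induction cs) auto

lemma well_formed_seqs [simp]: "well_formed (seqs cs) \<longleftrightarrow> (\<forall>c\<in>set cs. well_formed c)"
  by (induction cs) auto

lemma depth_seqs_le [simp]: "depth (seqs cs) \<le> d \<longleftrightarrow> (\<forall>c\<in>set cs. depth c \<le> d)"
  by (induction cs) auto

lemma depth_seqs_eq_0 [simp]: "depth (seqs cs) = 0 \<longleftrightarrow> (\<forall>c\<in>set cs. depth c = 0)"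
  by (induction cs) auto

lemma effect_simps [simp]:
  "effect (Const i c) s = assign i c s"
  "effect (Add i j k) s = assign i (fst s j + fst s k) s"
  "effect (Sub i j k) s = assign i (fst s j - fst s k) s"
  "effect (Load i j) s = assign i (snd s (fst s j)) s"
  "effect (Store i j) s = (fst s, (snd s)(fst s i := fst s j))"
  by (cases s; simp add: assign_def)+

definition copy :: "nat \<Rightarrow> nat \<Rightarrow> com" where
  "copy i j = seqs [Ins (Const i 0), Ins (Add i i j)]"

text \<open>Of the two truncated differences one is \<open>0\<close>, so their sum is the absolute
  difference, which vanishes exactly for equal letters.\<close>

definition compare :: "nat \<Rightarrow> com" where
  "compare j = seqs [Ins (Sub diff letter (letter_reg j)), Ins (Sub tmp (letter_reg j) letter),
     Ins (Add diff diff tmp)]"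

text \<open>The term \<open>1 - (n - pos)\<close> is positive once \<open>u\<close> is used up and
  then blocks a match, since the cell read is no longer an input letter. Raising coordinate
  \<open>k\<close> by one moves the table address by its power.\<close>

definition match_step :: "nat \<Rightarrow> nat \<Rightarrow> com" where
  "match_step k j = seqs [Ins (Load letter pos), compare j,
     Ins (Sub tmp 0 pos), Ins (Sub tmp 1 tmp), Ins (Add diff diff tmp),
     IfZ diff (seqs [Ins (Add pos pos 1), Ins (Add addr addr (power_reg k))])]"

definition match_word :: "nat \<Rightarrow> nat list \<Rightarrow> com" where
  "match_word k w = Seq (copy pos (digit_reg k)) (seqs (map (match_step k) w))"

text \<open>The successor's address is obtained from the current one by adding a power for each
  consumed letter, so no multiplication is required.\<close>

definition lookup :: "nat list list \<Rightarrow> bool \<Rightarrow> com" where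
  "lookup ps b = seqs [copy addr ptr,
     seqs (map (\<lambda>k. match_word k (orient b (ps ! k))) [0..<length ps]),
     Ins (Load (val b) addr)]"

text \<open>With truncated subtraction \<open>v + (w - v)\<close> is the maximum.\<close>

definition combine :: com where
  "combine = seqs [Ins (Sub tmp (val True) (val False)), Ins (Add (val False) (val False) tmp),
     Ins (Add (val False) (val False) 1)]"

definition check :: "nat \<Rightarrow> com" where
  "check m = Seq (Ins (Const flag 1))
     (seqs (map (\<lambda>k. seqs [Ins (Sub tmp 0 (digit_reg k)), IfZ tmp (Ins (Const flag 0))]) [0..<m]))"

text \<open>The lookups are made even in a finished state, where they may read entries not yet
  computed; their result is then overwritten by \<open>0\<close>.\<close>

definition process_state :: "nat list list \<Rightarrow> com" where
  "process_state ps = seqs [Ins (Sub ptr ptr 1), lookup ps False, lookup ps True, combine,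
     check (length ps), IfZ flag (Ins (Const (val False) 0)), Ins (Store ptr (val False))]"

text \<open>The outermost loop drives the most significant digit and all loops count down, so states
  appear in decreasing order of code and \<open>ptr\<close> can follow by single decrements.\<close>

primrec for_digits :: "nat \<Rightarrow> com \<Rightarrow> com" where
  "for_digits 0 c = c"
| "for_digits (Suc k) c = For (digit_reg k) (for_digits k c)"

text \<open>Cell \<open>idx - 1\<close> is inspected for \<open>idx = n, ..., 0\<close>; by
  truncation cell \<open>0\<close> is inspected twice, harmlessly. \<open>flag\<close> marks a
  letter that is already known.\<close>

definition find_letter :: "nat \<Rightarrow> com" where
  "find_letter j = For idx (seqs [Ins (Sub tmp idx 1), Ins (Load letter tmp), Ins (Const flag 0),
     seqs (map (\<lambda>k. Seq (compare k) (IfZ diff (Ins (Const flag 1)))) [0..<j]),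
     IfZ flag (copy (letter_reg j) letter)])"

text \<open>Multiplication by \<open>n + 1\<close> is carried out as \<open>n + 1\<close>
  additions.\<close>

definition next_power :: "nat \<Rightarrow> com" where
  "next_power k = Seq (Ins (Const (power_reg (Suc k)) 0))
     (For idx (Ins (Add (power_reg (Suc k)) (power_reg (Suc k)) (power_reg k))))"

text \<open>\<open>ptr\<close> starts just behind the last table cell because
  \<open>process_state\<close> decrements it before use.\<close>

definition main :: "nat \<Rightarrow> nat list list \<Rightarrow> com" where
  "main r ps = seqs [seqs (map find_letter [0..<r]),
     Ins (Const (power_reg 0) 1), seqs (map next_power [0..<length ps]),
     Ins (Add ptr 0 (power_reg (length ps))), for_digits (length ps) (process_state ps)]"

section \<open>Written registers, well-formedness and loop depth of the code\<close>

lemmas code_defs = copy_def compare_def match_step_def match_word_def lookup_def combine_def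
  check_def process_state_def find_letter_def next_power_def

lemma sem_copy [simp]: "i \<noteq> j \<Longrightarrow> sem (copy i j) s = assign i (fst s j) s"
  by (simp add: copy_def assign_def)

lemma compare_diff: "fst (sem (compare j) s) diff = 0 \<longleftrightarrow> fst s letter = fst s (letter_reg j)"
  by (auto simp: compare_def)

lemma writes_copy [simp]: "writes (copy i j) = {i}"
  and storeless_copy [simp]: "storeless (copy i j)"
  and writes_compare [simp]: "writes (compare j) = {diff, tmp}"
  and storeless_compare [simp]: "storeless (compare j)"
  and writes_match_step [simp]: "writes (match_step k j) = {letter, diff, tmp, pos, addr}"
  and storeless_match_step [simp]: "storeless (match_step k j)"
  and writes_combine [simp]: "writes combine = {tmp, val False}"
  and storeless_combine [simp]: "storeless combine"
  by (auto simp: code_defs)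

lemma writes_match_word [simp]: "writes (match_word k w) \<subseteq> {letter, diff, tmp, pos, addr}"
  and storeless_match_word [simp]: "storeless (match_word k w)"
  by (auto simp: match_word_def)

lemma writes_lookup: "writes (lookup ps b) \<subseteq> {letter, diff, tmp, pos, addr, val b}"
  by (auto simp: lookup_def dest: subsetD[OF writes_match_word])

lemma storeless_lookup [simp]: "storeless (lookup ps b)"
  by (simp add: lookup_def)

lemma writes_check: "writes (check m) \<subseteq> {tmp, flag}"
  and storeless_check [simp]: "storeless (check m)"
  by (auto simp: check_def)

lemma writes_process_state: "writes (process_state ps) \<subseteq> {2..<20}"
  using writes_lookup[of ps] writes_check[of "length ps"]
  unfolding process_state_def by fastforce

lemma writes_for_digits:
  "writes (for_digits k c) = digit_reg ` {..<k} \<union> writes c"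
  by (induction k) (auto simp: lessThan_Suc)

lemma well_formed_process_state: "well_formed (process_state ps)"
  by (auto simp: code_defs)

lemma well_formed_for_digits:
  "well_formed c \<Longrightarrow> writes c \<subseteq> {2..<20} \<Longrightarrow> well_formed (for_digits k c)"
proof (induction k)
  case (Suc k)
  then have "digit_reg k \<notin> writes c" using reg_ge(3)[of k] by auto
  then show ?case using Suc by (auto simp: writes_for_digits)
qed simp

lemma well_formed_main: "well_formed (main r ps)"
  using well_formed_for_digits[OF well_formed_process_state writes_process_state]
  by (auto simp: main_def find_letter_def next_power_def copy_def compare_def)

lemma depth_process_state: "depth (process_state ps) = 0"
  by (simp add: code_defs)

text \<open>The nested digit loops contribute one level per permutation; preprocessing has depth at
  most \<open>1\<close>, which a nonempty \<open>ps\<close> dominates.\<close>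

lemma depth_main:
  assumes "ps \<noteq> []"
  shows "depth (main r ps) \<le> length ps"
proof -
  have "depth (for_digits k (process_state ps)) = k" for k
    by (induction k) (simp_all add: depth_process_state)
  moreover have "depth (find_letter j) \<le> 1" "depth (next_power j) \<le> 1" for j
    by (auto simp: find_letter_def next_power_def copy_def compare_def)
  moreover have "1 \<le> length ps" using assms by (simp add: Suc_le_eq)
  ultimately show ?thesis unfolding main_def depth_seqs_le
    by (auto intro: order_trans)
qed

section \<open>Correctness of the table computation\<close>

lemma match_step_correct:
  assumes "fst s 0 = length u" "fst s 1 = 1" "\<And>i. i < length u \<Longrightarrow> snd s i = u ! i"
  shows "fst (sem (match_step k j) s) pos = advance u [fst s (letter_reg j)] (fst s pos)" (is ?pos)
    and "fst (sem (match_step k j) s) addr =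
      fst s addr + (advance u [fst s (letter_reg j)] (fst s pos) - fst s pos) * fst s (power_reg k)"
      (is ?addr)
proof -
  define s1 where "s1 = sem (compare j) (sem (Ins (Load letter pos)) s)"
  define s2 where
    "s2 = sem (seqs [Ins (Sub tmp 0 pos), Ins (Sub tmp 1 tmp), Ins (Add diff diff tmp)]) s1"
  have other: "fst s1 x = fst s x" if "x \<notin> {diff, tmp, letter}" for x
    using that by (simp add: s1_def sem_other_register)
  have "fst s1 diff = 0 \<longleftrightarrow> snd s (fst s pos) = fst s (letter_reg j)"
    unfolding s1_def by (subst compare_diff) simp
  then have diff: "fst s2 diff = 0 \<longleftrightarrow> fst s pos < length u \<and> u ! fst s pos = fst s (letter_reg j)"
    using assms by (auto simp: s2_def other)
  have other2: "fst s2 x = fst s x" if "x \<notin> {diff, tmp, letter}" for x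
    using that by (simp add: s2_def other)
  have "sem (match_step k j) s =
      sem (IfZ diff (seqs [Ins (Add pos pos 1), Ins (Add addr addr (power_reg k))])) s2"
    by (simp only: match_step_def s1_def s2_def seqs_simps sem.simps)
  then show ?pos ?addr
    using diff assms(2) by (auto simp: other2)
qed

lemma match_steps_correct:
  assumes "fst s 0 = length u" "fst s 1 = 1" "\<And>i. i < length u \<Longrightarrow> snd s i = u ! i"
    "\<And>j. j \<in> set w \<Longrightarrow> fst s (letter_reg j) = c j"
  shows "fst (sem (seqs (map (match_step k) w)) s) pos = advance u (map c w) (fst s pos)"
    and "fst (sem (seqs (map (match_step k) w)) s) addr =
      fst s addr + (advance u (map c w) (fst s pos) - fst s pos) * fst s (power_reg k)"
proof -
  have "fst (sem (seqs (map (match_step k) w)) s) pos = advance u (map c w) (fst s pos) \<and>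
    fst (sem (seqs (map (match_step k) w)) s) addr =
      fst s addr + (advance u (map c w) (fst s pos) - fst s pos) * fst s (power_reg k)"
    using assms
  proof (induction w arbitrary: s)
    case (Cons j w)
    let ?s = "sem (match_step k j) s"
    have other: "fst ?s x = fst s x" if "x \<notin> {letter, diff, tmp, pos, addr}" for x
      using that by (simp add: sem_other_register)
    have mem: "snd ?s = snd s" by (simp add: sem_storeless)
    define p where "p = advance u [c j] (fst s pos)"
    define q where "q = advance u (map c w) p"
    have step: "fst ?s pos = p" "fst ?s addr = fst s addr + (p - fst s pos) * fst s (power_reg k)"
      using match_step_correct[of s u k j] Cons.prems by (simp_all add: p_def)
    have IH: "fst (sem (seqs (map (match_step k) w)) ?s) pos = q \<and>
      fst (sem (seqs (map (match_step k) w)) ?s) addr =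
        fst ?s addr + (q - p) * fst ?s (power_reg k)"
      unfolding q_def step(1)[symmetric]
      by (rule Cons.IH) (use Cons.prems in \<open>simp_all add: other mem\<close>)
    have q: "advance u (map c (j # w)) (fst s pos) = q" by (simp add: p_def q_def)
    \<comment> \<open>Greedy positions never decrease, so the truncated increments
      telescope.\<close>
    have "fst s pos \<le> p" "p \<le> q" unfolding p_def q_def by (rule advance_ge)+
    then have "(p - fst s pos) + (q - p) = q - fst s pos" by simp
    then have "(p - fst s pos) * B + (q - p) * B = (q - fst s pos) * B" for B
      by (metis add_mult_distrib)
    then show ?case unfolding q using IH step by (simp add: other add.assoc)
  qed simp
  then show "fst (sem (seqs (map (match_step k) w)) s) pos = advance u (map c w) (fst s pos)"
    and "fst (sem (seqs (map (match_step k) w)) s) addr =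
      fst s addr + (advance u (map c w) (fst s pos) - fst s pos) * fst s (power_reg k)"
    by simp_all
qed

text \<open>The program may depend on \<open>r\<close> only, so \<open>ps\<close> permutes indices;
  the input enters through the naming \<open>c\<close> of indices by letters.\<close>

locale formation_width_program =
  fixes u :: "nat list" and r :: nat and ps :: "nat list list" and c :: "nat \<Rightarrow> nat"
  assumes letters: "bij_betw c {..<r} (set u)"
    and perms: "set ps = permutations_of_set {..<r}"
begin

abbreviation n where "n \<equiv> length u"
abbreviation m where "m \<equiv> length ps"

definition word :: "nat \<Rightarrow> nat list" where "word k = map c (ps ! k)"

definition env :: "store \<Rightarrow> bool" where
  "env s \<longleftrightarrow> fst s 0 = n \<and> fst s 1 = 1 \<and> (\<forall>i<n. snd s i = u ! i) \<and>
     (\<forall>j<r. fst s (letter_reg j) = c j) \<and> (\<forall>k\<le>m. fst s (power_reg k) = (n + 1) ^ k)"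

text \<open>The table is filled from its upper end: entries with code at least \<open>a\<close> are
  final, and nothing is claimed below.\<close>

definition table :: "nat \<Rightarrow> store \<Rightarrow> bool" where
  "table a s \<longleftrightarrow> env s \<and> fst s ptr = n + a \<and>
     (\<forall>q. (\<forall>k<m. q k \<le> n) \<longrightarrow> a \<le> encode (n + 1) m q \<longrightarrow>
        snd s (n + encode (n + 1) m q) = remaining u word m q)"

definition state :: "store \<Rightarrow> nat \<Rightarrow> nat" where
  "state s k = fst s (digit_reg k)"

lemma words: "word ` {..<m} = permutations_of_set (set u)"
proof -
  have "set ps = (!) ps ` {..<m}" by (auto simp: set_conv_nth)
  then have "word ` {..<m} = map c ` set ps" by (simp add: word_def image_image)
  also have "\<dots> = permutations_of_set (c ` {..<r})"
    unfolding perms using letters permutations_of_set_image_inj[of c "{..<r}"]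
    by (simp add: bij_betw_def)
  finally show ?thesis using letters by (simp add: bij_betw_def)
qed

lemma set_word: "k < m \<Longrightarrow> set (word k) = set u"
  using words by (auto simp: permutations_of_set_def)

lemma m_pos: "0 < m"
  using perms by (metis finite_lessThan length_greater_0_conv permutations_of_set_empty_iff set_empty2)

lemma env_cong:
  assumes "env s" "\<And>x. x \<in> {0, 1} \<union> range letter_reg \<union> range power_reg \<Longrightarrow> fst t x = fst s x"
    "\<And>i. i < n \<Longrightarrow> snd t i = snd s i"
  shows "env t"
  using assms unfolding env_def by auto

lemma env_sem: "env s \<Longrightarrow> storeless d \<Longrightarrow> writes d \<subseteq> {2..<20} \<Longrightarrow> env (sem d s)"
proof (rule env_cong)
  fix x assume "x \<in> {0, 1} \<union> range letter_reg \<union> range power_reg" "writes d \<subseteq> {2..<20}"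
  moreover have "\<not> letter_reg j < 20" "\<not> power_reg j < 20" for j using reg_ge[of j] by simp_all
  ultimately show "fst (sem d s) x = fst s x"
    by (intro sem_other_register) fastforce
qed (simp_all add: sem_storeless)

lemma state_sem: "writes d \<subseteq> {2..<20} \<Longrightarrow> state (sem d s) = state s"
proof
  fix k assume "writes d \<subseteq> {2..<20}"
  moreover have "\<not> digit_reg k < 20" using reg_ge(3)[of k] by simp
  ultimately have "digit_reg k \<notin> writes d" by auto
  then show "state (sem d s) k = state s k" unfolding state_def by (rule sem_other_register)
qed

lemma match_word_correct:
  assumes "env s" "k < m" "set w \<subseteq> {..<r}"
  shows "fst (sem (match_word k w) s) addr =
    fst s addr + (advance u (map c w) (state s k) - state s k) * (n + 1) ^ k"
proof -
  let ?s = "sem (copy pos (digit_reg k)) s"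
  have s: "fst ?s pos = state s k" "fst ?s x = fst s x" if "x \<noteq> pos" for x
    using that by (simp_all add: state_def)
  have "fst (sem (seqs (map (match_step k) w)) ?s) addr =
    fst ?s addr + (advance u (map c w) (fst ?s pos) - fst ?s pos) * fst ?s (power_reg k)"
    by (rule match_steps_correct)
       (use assms in \<open>auto simp: env_def\<close>)
  then show ?thesis
    using assms(1,2) by (simp add: match_word_def env_def state_def)
qed

lemma lookup_correct:
  assumes env: "env s" and ptr: "fst s ptr = n + encode (n + 1) m (state s)"
  shows "fst (sem (lookup ps b) s) (val b) = snd s (n + encode (n + 1) m (move u word b (state s)))"
proof -
  let ?p = "state s" and ?q = "move u word b (state s)"
  define t where "t k = sem (seqs (map (\<lambda>k. match_word k (orient b (ps ! k))) [0..<k]))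
      (sem (copy addr ptr) s)" for k
  \<comment> \<open>After \<open>k\<close> words, the first \<open>k\<close> digits in the address
    have been changed to those of the successor.\<close>
  have "env (t k) \<and> state (t k) = ?p \<and>
      fst (t k) addr = fst s ptr + (\<Sum>i<k. (?q i - ?p i) * (n + 1) ^ i)" if "k \<le> m" for k
    using that
  proof (induction k)
    case 0
    have "env (t 0)" unfolding t_def by (simp del: sem_copy) (rule env_sem[OF env]; simp)
    moreover have "state (t 0) = ?p" unfolding t_def by (simp del: sem_copy) (rule state_sem; simp)
    ultimately show ?case by (simp add: t_def)
  next
    case (Suc k)
    let ?w = "orient b (ps ! k)"
    have t: "t (Suc k) = sem (match_word k ?w) (t k)" by (simp add: t_def)
    have w: "writes (match_word k ?w) \<subseteq> {2..<20}" by (rule order_trans[OF writes_match_word]) simp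
    have "ps ! k \<in> permutations_of_set {..<r}" using Suc.prems perms by (metis Suc_le_eq nth_mem)
    then have "set ?w \<subseteq> {..<r}" by (simp add: permutations_of_set_def)
    then have "fst (t (Suc k)) addr =
        fst (t k) addr + (advance u (map c ?w) (?p k) - ?p k) * (n + 1) ^ k"
      unfolding t using match_word_correct[of "t k" k ?w] Suc by simp
    moreover have "advance u (map c ?w) (?p k) = ?q k" by (simp add: move_def word_def map_orient)
    ultimately show ?case
      using Suc env_sem[OF _ storeless_match_word w] state_sem[OF w] t by simp
  qed
  then have "fst (t m) addr = fst s ptr + (\<Sum>i<m. (?q i - ?p i) * (n + 1) ^ i)" by blast
  also have "\<dots> = n + (\<Sum>i<m. ?p i * (n + 1) ^ i + (?q i - ?p i) * (n + 1) ^ i)"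
    unfolding ptr encode_def by (simp add: sum.distrib)
  also have "?p i * B + (?q i - ?p i) * B = ?q i * B" for i B
    by (simp add: add_mult_distrib[symmetric] move_def advance_ge)
  then have "n + (\<Sum>i<m. ?p i * (n + 1) ^ i + (?q i - ?p i) * (n + 1) ^ i) = n + encode (n + 1) m ?q"
    unfolding encode_def by (simp only:)
  finally have "fst (t m) addr = n + encode (n + 1) m ?q" .
  moreover have "snd (t m) = snd s" by (simp add: t_def sem_storeless)
  moreover have "sem (lookup ps b) s = sem (Ins (Load (val b) addr)) (t m)"
    by (simp add: lookup_def t_def)
  ultimately show ?thesis by simp
qed

lemma check_correct:
  assumes "env s" "\<And>k. k < m \<Longrightarrow> state s k \<le> n"
  shows "fst (sem (check m) s) flag = 0 \<longleftrightarrow> (\<exists>k<m. state s k = n)"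
proof -
  let ?c = "\<lambda>k. seqs [Ins (Sub tmp 0 (digit_reg k)), IfZ tmp (Ins (Const flag 0))]"
  define t where "t k = sem (seqs (map ?c [0..<k])) (assign flag 1 s)" for k
  have "fst (t k) flag = 0 \<longleftrightarrow> (\<exists>i<k. state s i = n)" if "k \<le> m" for k
    using that
  proof (induction k)
    case (Suc k)
    have "fst (t k) x = fst s x" if "x \<notin> {tmp, flag}" for x
      unfolding t_def using that by (subst sem_other_register) auto
    \<comment> \<open>Coordinates are at most \<open>n\<close>, so the truncated difference vanishes
      only at equality.\<close>
    then have "fst (t k) 0 - fst (t k) (digit_reg k) = 0 \<longleftrightarrow> state s k = n"
      using assms(1) assms(2)[of k] Suc.prems by (auto simp: env_def state_def)
    moreover have "t (Suc k) = sem (?c k) (t k)" by (simp add: t_def)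
    ultimately show ?case using Suc by (auto simp: less_Suc_eq)
  qed (simp add: t_def)
  then show ?thesis by (simp add: check_def t_def)
qed

lemma process_state_correct:
  assumes table: "table (encode (n + 1) m (state s) + 1) s" and le: "\<And>k. k < m \<Longrightarrow> state s k \<le> n"
  shows "table (encode (n + 1) m (state s)) (sem (process_state ps) s)"
proof -
  let ?p = "state s"
  let ?a = "encode (n + 1) m ?p"
  let ?v = "\<lambda>b. snd s (n + encode (n + 1) m (move u word b ?p))"
  define s1 where "s1 = sem (Ins (Sub ptr ptr 1)) s"
  define s2 where "s2 = sem (lookup ps False) s1"
  define s3 where "s3 = sem (lookup ps True) s2"
  define s4 where "s4 = sem combine s3"
  define s5 where "s5 = sem (check m) s4"
  define s6 where "s6 = sem (IfZ flag (Ins (Const (val False) 0))) s5"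
  have s7: "sem (process_state ps) s = sem (Ins (Store ptr (val False))) s6"
    by (simp only: process_state_def seqs_simps sem.simps s1_def s2_def s3_def s4_def s5_def s6_def)
  have ltw: "writes (Ins (Sub ptr ptr 1)) \<subseteq> {2..<20}" "writes (lookup ps b) \<subseteq> {2..<20}"
    "writes combine \<subseteq> {2..<20}" "writes (check m) \<subseteq> {2..<20}"
    "writes (IfZ flag (Ins (Const (val False) 0))) \<subseteq> {2..<20}" for b
    using writes_lookup[of ps b] writes_check[of m] by auto
  have st: "state s1 = ?p" "state s2 = ?p" "state s3 = ?p" "state s4 = ?p" "state s5 = ?p" "state s6 = ?p"
    unfolding s1_def s2_def s3_def s4_def s5_def s6_def by (simp_all only: state_sem[OF ltw(1)]
      state_sem[OF ltw(2)] state_sem[OF ltw(3)] state_sem[OF ltw(4)] state_sem[OF ltw(5)])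
  have env: "env s" using table by (simp add: table_def)
  have env1: "env s1" unfolding s1_def by (rule env_sem[OF env _ ltw(1)]) simp
  have env2: "env s2" unfolding s2_def by (rule env_sem[OF env1 _ ltw(2)]) simp
  have env3: "env s3" unfolding s3_def by (rule env_sem[OF env2 _ ltw(2)]) simp
  have env4: "env s4" unfolding s4_def by (rule env_sem[OF env3 _ ltw(3)]) simp
  have env5: "env s5" unfolding s5_def by (rule env_sem[OF env4 _ ltw(4)]) simp
  have env6: "env s6" unfolding s6_def by (rule env_sem[OF env5 _ ltw(5)]) simp
  have m1: "snd s1 = snd s" and m2: "snd s2 = snd s" and m6: "snd s6 = snd s"
    unfolding s1_def s2_def s3_def s4_def s5_def s6_def by (simp_all add: sem_storeless)
  have wl: "x \<notin> writes (lookup ps b)" if "x \<notin> {3..<8}" "x \<noteq> val b" for x b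
    using writes_lookup[of ps b] that by auto
  have wc: "x \<notin> writes (check m)" if "x \<notin> {tmp, flag}" for x
    using writes_check[of m] that by auto
  have p1: "fst s1 ptr = n + ?a" using table by (simp add: s1_def table_def env_def)
  have p2: "fst s2 ptr = n + ?a" unfolding s2_def by (subst sem_other_register[OF wl]) (simp_all add: p1)
  have p3: "fst s3 ptr = n + ?a" unfolding s3_def by (subst sem_other_register[OF wl]) (simp_all add: p2)
  have p4: "fst s4 ptr = n + ?a" unfolding s4_def by (subst sem_other_register) (simp_all add: p3)
  have p5: "fst s5 ptr = n + ?a" unfolding s5_def by (subst sem_other_register[OF wc]) (simp_all add: p4)
  have p6: "fst s6 ptr = n + ?a" using p5 by (simp add: s6_def)
  have v2: "fst s2 (val False) = ?v False"
    unfolding s2_def using lookup_correct[OF env1, of False] p1 by (simp only: st m1)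
  have "fst s3 (val False) = ?v False"
    unfolding s3_def v2[symmetric] by (rule sem_other_register[OF wl]) simp_all
  moreover have "fst s3 (val True) = ?v True"
    unfolding s3_def using lookup_correct[OF env2, of True] p2 by (simp only: st m2)
  moreover have "fst s3 1 = 1" using env3 by (simp add: env_def)
  ultimately have "fst s4 (val False) = Suc (max (?v False) (?v True))"
    by (simp add: s4_def combine_def)
  moreover have "fst s5 (val False) = fst s4 (val False)"
    unfolding s5_def by (rule sem_other_register[OF wc]) simp
  moreover have "fst s5 flag = 0 \<longleftrightarrow> (\<exists>k<m. ?p k = n)"
    unfolding s5_def using check_correct[OF env4] le by (simp add: st)
  ultimately have v6: "fst s6 (val False) =
      (if \<exists>k<m. ?p k = n then 0 else Suc (max (?v False) (?v True)))"
    by (simp add: s6_def)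
  have "fst s6 (val False) = remaining u word m ?p"
  proof (cases "\<exists>k<m. ?p k = n")
    case True
    then show ?thesis using v6 remaining_0[of m ?p u word] by simp
  next
    case False
    then have lt: "?p k < n" if "k < m" for k using le[OF that] that by (meson le_neq_implies_less)
    have "?v b = remaining u word m (move u word b ?p)" for b
    proof -
      \<comment> \<open>No coordinate is finished, so the block raises all of them and the
        successor's entry is among those already correct.\<close>
      have "?a < encode (n + 1) m (move u word b ?p)"
        by (rule encode_strict_mono[OF m_pos])
           (auto intro: move_gt[where u = u and W = word and m = m] simp: set_word m_pos lt)
      moreover have "move u word b ?p k \<le> n" if "k < m" for k
        by (rule move_le) (rule le[OF that])
      ultimately show ?thesis using table by (simp add: table_def)
    qed
    then show ?thesis using v6 False remaining_step[of m word u ?p] lt set_word m_pos by simp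
  qed
  then have final: "sem (process_state ps) s = (fst s6, (snd s)(n + ?a := remaining u word m ?p))"
    by (simp add: s7 p6 m6)
  \<comment> \<open>The written cell has address at least \<open>n\<close>, so the input
    survives.\<close>
  have "env (sem (process_state ps) s)" unfolding final by (rule env_cong[OF env6]) (simp_all add: m6)
  moreover have "snd (sem (process_state ps) s) (n + encode (n + 1) m q) = remaining u word m q"
    if q: "\<forall>k<m. q k \<le> n" "?a \<le> encode (n + 1) m q" for q
  proof (cases "encode (n + 1) m q = ?a")
    case True
    \<comment> \<open>Equal codes force equal digits below \<open>m\<close>, so the new value serves
      every \<open>q\<close> sharing this cell.\<close>
    have "remaining u word m q = remaining u word m ?p"
    proof (rule remaining_cong)
      fix k assume "k < m"
      then show "q k = ?p k"
        using q(1) le True by (intro encode_inj[of m q "n + 1" ?p]) (auto simp: less_Suc_eq_le)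
    qed
    then show ?thesis using True by (simp add: final)
  next
    case False
    then show ?thesis using q table by (simp add: final table_def)
  qed
  ultimately show ?thesis using p6 by (simp add: table_def final)
qed

text \<open>The digits from \<open>k\<close> on are fixed by the outer loops and contribute the sum;
  the inner \<open>k\<close> loops fill the block of \<open>(n + 1) ^ k\<close> entries above
  it.\<close>

lemma for_digits_correct:
  assumes "k \<le> m" "\<And>i. k \<le> i \<Longrightarrow> i < m \<Longrightarrow> state s i \<le> n"
    and "table ((\<Sum>i\<in>{k..<m}. state s i * (n + 1) ^ i) + (n + 1) ^ k) s"
  shows "table (\<Sum>i\<in>{k..<m}. state s i * (n + 1) ^ i) (sem (for_digits k (process_state ps)) s)"
  using assms
proof (induction k arbitrary: s)
  case 0
  then show ?case
    using process_state_correct[of s] by (simp add: encode_def atLeast0LessThan)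
next
  case (Suc k)
  let ?B = "n + 1"
  let ?h = "\<Sum>i\<in>{Suc k..<m}. state s i * ?B ^ i"
  let ?f = "\<lambda>j s. sem (for_digits k (process_state ps)) (assign (digit_reg k) j s)"
  \<comment> \<open>Values \<open>j\<close> and above of digit \<open>k\<close> are done. At
    \<open>j = n + 1\<close> this is the hypothesis, as \<open>(n + 1) * (n + 1) ^ k\<close> is the
    next power.\<close>
  define I where "I j t \<longleftrightarrow> j \<le> Suc n \<and> table (?h + j * ?B ^ k) t \<and> (\<forall>i>k. state t i = state s i)"
    for j t
  have "I 0 (iter ?f (Suc n) s)"
  proof (rule iter_invariant)
    show "I (Suc n) s" using Suc.prems(3) by (simp add: I_def)
  next
    fix j t assume "j < Suc n" and I: "I (Suc j) t"
    let ?t = "assign (digit_reg k) j t"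
    have st: "state ?t k = j" "i > k \<Longrightarrow> state ?t i = state s i" for i
      using I by (simp_all add: state_def I_def)
    have sum: "(\<Sum>i\<in>{k..<m}. state ?t i * ?B ^ i) = ?h + j * ?B ^ k"
      using Suc.prems(1) st by (subst sum.atLeast_Suc_lessThan) simp_all
    have "env ?t" by (rule env_cong[of t "assign (digit_reg k) j t"]) (use I in \<open>auto simp: I_def table_def\<close>)
    then have "table (?h + j * ?B ^ k + ?B ^ k) ?t"
      using I by (simp add: I_def table_def add_ac)
    moreover have "state ?t i \<le> n" if "k \<le> i" "i < m" for i
      using that st Suc.prems(2)[of i] \<open>j < Suc n\<close> by (cases "i = k") auto
    ultimately have "table (?h + j * ?B ^ k) (?f j t)"
      using Suc.IH[of ?t] Suc.prems(1) unfolding sum by simp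
    moreover have "state (?f j t) i = state s i" if "i > k" for i
    proof -
      have "\<not> digit_reg i < 20" using reg_ge(3)[of i] by simp
      then have "digit_reg i \<notin> writes (for_digits k (process_state ps))"
        using that writes_process_state[of ps] by (auto simp: writes_for_digits)
      then show ?thesis using st(2)[OF that] by (simp add: state_def sem_other_register)
    qed
    ultimately show "I j (?f j t)" using \<open>j < Suc n\<close> by (simp add: I_def)
  qed
  moreover have "fst s 0 = n" using Suc.prems(3) by (simp add: table_def env_def)
  ultimately show ?case unfolding I_def by (simp del: iter.simps)
qed

lemma all_digits_correct:
  assumes "env s" "fst s ptr = n + (n + 1) ^ m"
  shows "fst (sem (for_digits m (process_state ps)) s) ptr = n"
    and "snd (sem (for_digits m (process_state ps)) s) n = fw u"
proof -
  \<comment> \<open>No state has a code this large, so the initial table condition holds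
    vacuously.\<close>
  have "\<not> (n + 1) ^ m \<le> encode (n + 1) m q" if "\<forall>k<m. q k \<le> n" for q
    using that encode_lt[of m q "n + 1"] by (simp add: less_Suc_eq_le not_le)
  then have "table ((n + 1) ^ m) s" using assms by (auto simp: table_def)
  then have "table 0 (sem (for_digits m (process_state ps)) s)"
    using for_digits_correct[of m s] by simp
  \<comment> \<open>The start state has code \<open>0\<close>, so its value, the formation width,
    ends up in cell \<open>n\<close>.\<close>
  moreover have "encode (n + 1) m (\<lambda>_. 0) = 0" by (simp add: encode_def)
  ultimately show "fst (sem (for_digits m (process_state ps)) s) ptr = n"
    "snd (sem (for_digits m (process_state ps)) s) n = fw u"
    using fw_eq_remaining[OF words] unfolding table_def by (auto dest: spec[of _ "\<lambda>_. 0"])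
qed

end

section \<open>Preprocessing: distinct letters of the input and powers of the base\<close>

lemma find_letter_correct:
  assumes "fst s 0 = length u" "\<And>i. i < length u \<Longrightarrow> snd s i = u ! i" "fst s 1 = 1"
    and new: "\<not> set u \<subseteq> (\<lambda>k. fst s (letter_reg k)) ` {..<j}"
  shows "fst (sem (find_letter j) s) (letter_reg j)
    \<in> set u - (\<lambda>k. fst s (letter_reg k)) ` {..<j}"
proof -
  let ?S = "(\<lambda>k. fst s (letter_reg k)) ` {..<j}"
  let ?scan = "\<lambda>k. Seq (compare k) (IfZ diff (Ins (Const flag 1)))"
  let ?c = "seqs [Ins (Sub tmp idx 1), Ins (Load letter tmp), Ins (Const flag 0),
     seqs (map ?scan [0..<j]), IfZ flag (copy (letter_reg j) letter)]"
  let ?f = "\<lambda>i t. sem ?c (assign idx i t)"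
  \<comment> \<open>Either a new letter has been stored, or all positions scanned so far, those from
    \<open>i - 1\<close> on, hold known letters; \<open>i \<le> i' + 1\<close> avoids
    truncation.\<close>
  define I where "I i t \<longleftrightarrow> snd t = snd s \<and>
      (\<forall>x. x \<notin> {tmp, letter, flag, diff, idx, letter_reg j} \<longrightarrow> fst t x = fst s x) \<and>
      (fst t (letter_reg j) \<in> set u - ?S \<or> (\<forall>i'<length u. i \<le> i' + 1 \<longrightarrow> u ! i' \<in> ?S))" for i t
  have "I 0 (iter ?f (Suc (length u)) s)"
  proof (rule iter_invariant)
    show "I (Suc (length u)) s" by (auto simp: I_def)
  next
    fix i t assume i: "i < Suc (length u)" and I: "I (Suc i) t"
    \<comment> \<open>At \<open>i = 0\<close> truncation reads cell \<open>0\<close> again, which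
      must be an input cell.\<close>
    have "length u > 0" using new by auto
    then have i': "i - 1 < length u" using i by linarith
    define t1 where "t1 = sem (seqs [Ins (Sub tmp idx 1), Ins (Load letter tmp), Ins (Const flag 0)])
      (assign idx i t)"
    define t2 where "t2 k = sem (seqs (map ?scan [0..<k])) t1" for k
    have f: "?f i t = sem (IfZ flag (copy (letter_reg j) letter)) (t2 j)"
      by (simp add: t1_def t2_def)
    have t1: "fst t1 letter = u ! (i - 1)" "fst t1 flag = 0" "snd t1 = snd s"
      using I assms(2)[OF i'] assms(3) by (simp_all add: t1_def I_def)
    have t1_other: "fst t1 x = fst t x" if "x \<notin> {tmp, letter, flag, idx}" for x
      using that by (simp add: t1_def)
    have t2_other: "fst (t2 k) x = fst t1 x" if "x \<notin> {tmp, flag, diff}" for k x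
      unfolding t2_def using that by (subst sem_other_register) auto
    have mem: "snd (t2 k) = snd s" for k
      unfolding t2_def by (subst sem_storeless) (auto simp: t1)
    have "fst (t2 k) flag = 0 \<longleftrightarrow> (\<forall>k'<k. u ! (i - 1) \<noteq> fst s (letter_reg k'))" if "k \<le> j" for k
      using that
    proof (induction k)
      case (Suc k)
      have "fst (t2 k) (letter_reg k) = fst s (letter_reg k)"
        using I Suc.prems by (simp add: t2_other t1_other I_def)
      then have "fst (sem (compare k) (t2 k)) diff = 0 \<longleftrightarrow> u ! (i - 1) = fst s (letter_reg k)"
        by (simp add: compare_diff t2_other t1)
      moreover have "fst (sem (compare k) (t2 k)) flag = fst (t2 k) flag"
        by (rule sem_other_register) simp
      moreover have "t2 (Suc k) = sem (?scan k) (t2 k)" by (simp add: t2_def)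
      ultimately show ?case using Suc by (auto simp: less_Suc_eq)
    qed (simp add: t2_def t1)
    then have flag: "fst (t2 j) flag = 0 \<longleftrightarrow> u ! (i - 1) \<notin> ?S" by auto
    have other: "fst (?f i t) x = fst s x" if "x \<notin> {tmp, letter, flag, diff, idx, letter_reg j}" for x
      using that I unfolding f by (simp add: t2_other t1_other I_def)
    have mem': "snd (?f i t) = snd s" unfolding f by (simp add: mem)
    have "fst (?f i t) (letter_reg j) \<in> set u - ?S \<or> (\<forall>i'<length u. i \<le> i' + 1 \<longrightarrow> u ! i' \<in> ?S)"
    proof (cases "u ! (i - 1) \<in> ?S")
      case True
      then have "fst (?f i t) (letter_reg j) = fst t (letter_reg j)"
        unfolding f using flag by (simp add: t2_other t1_other)
      moreover have "\<forall>i'<length u. i \<le> i' + 1 \<longrightarrow> u ! i' \<in> ?S"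
        if old: "\<forall>i'<length u. Suc i \<le> i' + 1 \<longrightarrow> u ! i' \<in> ?S"
      proof (intro allI impI)
        fix i' assume "i' < length u" "i \<le> i' + 1"
        then show "u ! i' \<in> ?S" using old True by (cases "i = i' + 1") auto
      qed
      ultimately show ?thesis using I unfolding I_def by metis
    next
      case False
      then have "fst (?f i t) (letter_reg j) = u ! (i - 1)"
        unfolding f using flag by (simp add: t2_other t1)
      then show ?thesis using False i' by simp
    qed
    then show "I i (?f i t)" unfolding I_def using other mem' by blast
  qed
  then have "fst (sem (find_letter j) s) (letter_reg j) \<in> set u - ?S \<or> (\<forall>i<length u. u ! i \<in> ?S)"
    unfolding find_letter_def sem.simps assms(1) I_def by auto
  then show ?thesis using new by (auto simp: in_set_conv_nth)
qed

lemma writes_find_letter: "writes (find_letter j) = {tmp, letter, flag, idx, letter_reg j} \<union> (if j = 0 then {} else {diff})"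
  and storeless_find_letter [simp]: "storeless (find_letter j)"
  by (auto simp: find_letter_def)

text \<open>While fewer than \<open>r\<close> letters are known, counting leaves a new one to find.
  In the end \<open>r\<close> distinct elements exhaust a set of size \<open>r\<close>.\<close>

lemma find_letters_correct:
  assumes "fst s 0 = length u" "\<And>i. i < length u \<Longrightarrow> snd s i = u ! i" "fst s 1 = 1"
    and "card (set u) = r"
  shows "bij_betw (\<lambda>j. fst (sem (seqs (map find_letter [0..<r])) s) (letter_reg j)) {..<r} (set u)"
proof -
  define t where "t k = sem (seqs (map find_letter [0..<k])) s" for k
  have mem: "snd (t k) = snd s" for k
    unfolding t_def by (rule sem_storeless) simp
  have other: "fst (t k) x = fst s x" if "x < 2" for k x
    unfolding t_def using that by (subst sem_other_register) (auto simp: writes_find_letter split: if_splits)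
  have "inj_on (\<lambda>j. fst (t k) (letter_reg j)) {..<k} \<and> (\<lambda>j. fst (t k) (letter_reg j)) ` {..<k} \<subseteq> set u"
    if "k \<le> r" for k
    using that
  proof (induction k)
    case (Suc k)
    let ?g = "\<lambda>j. fst (t k) (letter_reg j)" and ?h = "\<lambda>j. fst (t (Suc k)) (letter_reg j)"
    have t: "t (Suc k) = sem (find_letter k) (t k)" by (simp add: t_def)
    have old: "?h j = ?g j" if "j < k" for j
      unfolding t using that by (subst sem_other_register) (auto simp: writes_find_letter split: if_splits)
    have "\<not> set u \<subseteq> ?g ` {..<k}"
    proof
      assume "set u \<subseteq> ?g ` {..<k}"
      then have "card (set u) \<le> card {..<k}" by (rule surj_card_le[rotated]) simp
      then show False using assms(4) Suc.prems by simp
    qed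
    then have "?h k \<in> set u - ?g ` {..<k}"
      unfolding t using assms(1-3) by (intro find_letter_correct) (simp_all add: mem other)
    moreover have "?h ` {..<k} = ?g ` {..<k}" using old by (intro image_cong) simp_all
    moreover have "inj_on ?h {..<k} = inj_on ?g {..<k}" using old by (intro inj_on_cong) simp
    ultimately show ?case using Suc by (simp add: lessThan_Suc)
  qed simp
  from this[of r] show ?thesis
    using assms(4) unfolding t_def[symmetric]
    by (simp add: bij_betw_def card_image card_subset_eq)
qed

lemma writes_next_power: "writes (next_power k) = {power_reg (Suc k), idx}"
  and storeless_next_power [simp]: "storeless (next_power k)"
  by (auto simp: next_power_def)

lemma next_power_correct:
  "fst (sem (next_power k) s) (power_reg (Suc k)) = (fst s 0 + 1) * fst s (power_reg k)"
proof -
  let ?f = "\<lambda>i. sem (Ins (Add (power_reg (Suc k)) (power_reg (Suc k)) (power_reg k))) \<circ> assign idx i"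
  define I :: "nat \<Rightarrow> store \<Rightarrow> bool" where "I i t \<longleftrightarrow> fst t (power_reg k) = fst s (power_reg k) \<and> i \<le> fst s 0 + 1 \<and>
      fst t (power_reg (Suc k)) = (fst s 0 + 1 - i) * fst s (power_reg k)" for i t
  have "I 0 (iter ?f (Suc (fst s 0)) (assign (power_reg (Suc k)) 0 s))"
  proof (rule iter_invariant)
    show "I (Suc (fst s 0)) (assign (power_reg (Suc k)) 0 s)" by (simp add: I_def)
  next
    fix i t assume "i < Suc (fst s 0)" "I (Suc i) t"
    moreover from this have "fst s 0 + 1 - i = Suc (fst s 0 - i)" by simp
    ultimately show "I i (?f i t)" by (simp add: I_def)
  qed
  then show ?thesis by (simp add: next_power_def I_def comp_def del: iter.simps)
qed

lemma powers_correct: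
  assumes "fst s (power_reg 0) = 1" "k \<le> K"
  shows "fst (sem (seqs (map next_power [0..<K])) s) (power_reg k) = (fst s 0 + 1) ^ k"
  using assms(2)
proof (induction K arbitrary: k)
  case (Suc K)
  let ?t = "sem (seqs (map next_power [0..<K])) s"
  have "fst ?t 0 = fst s 0" by (rule sem_other_register) (auto simp: writes_next_power)
  then show ?case
    using Suc next_power_correct[of K ?t]
    by (cases "k = Suc K") (simp_all add: sem_other_register writes_next_power)
qed (simp add: assms)

lemma main_correct:
  assumes "fst s 0 = length u" "fst s 1 = 1" "\<And>i. i < length u \<Longrightarrow> snd s i = u ! i"
    and r: "card (set u) = r" and ps: "set ps = permutations_of_set {..<r}"
  shows "snd (sem (main r ps) s) (fst (sem (main r ps) s) ptr) = fw u"
proof -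
  let ?m = "length ps"
  define s1 where "s1 = sem (seqs (map find_letter [0..<r])) s"
  define s2 where "s2 = assign (power_reg 0) 1 s1"
  define s3 where "s3 = sem (seqs (map next_power [0..<?m])) s2"
  define s4 where "s4 = sem (Ins (Add ptr 0 (power_reg ?m))) s3"
  have main: "sem (main r ps) s = sem (for_digits ?m (process_state ps)) s4"
    by (simp add: main_def s1_def s2_def s3_def s4_def)
  define c where "c j = fst s1 (letter_reg j)" for j
  interpret formation_width_program u r ps c
  proof
    show "bij_betw c {..<r} (set u)"
      unfolding c_def s1_def using assms by (intro find_letters_correct)
  qed (rule ps)
  have low1: "fst s1 x = fst s x" if "x < 2" for x
    unfolding s1_def using that by (subst sem_other_register) (auto simp: writes_find_letter split: if_splits)
  have s3_other: "fst s3 x = fst s2 x" if "x \<notin> range power_reg" "x \<noteq> idx" for x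
    unfolding s3_def using that by (subst sem_other_register) (auto simp: writes_next_power)
  have low3: "fst s3 x = fst s x" if "x < 2" for x
  proof -
    have x: "x \<noteq> power_reg k" for k using that reg_ge(2)[of k] by linarith
    have "fst s3 x = fst s2 x" by (rule s3_other) (use x in blast, use that in simp)
    then show ?thesis using x low1[OF that] by (simp add: s2_def)
  qed
  have pow: "fst s3 (power_reg k) = (length u + 1) ^ k" if "k \<le> ?m" for k
    unfolding s3_def using powers_correct[of s2 k ?m] that assms(1) low1[of 0] by (simp add: s2_def)
  have "fst s3 (letter_reg j) = c j" for j
    by (subst s3_other) (auto simp: s2_def c_def)
  moreover have "snd s4 = snd s"
    by (simp add: s4_def s3_def s2_def s1_def sem_storeless)
  ultimately have "env s4"
    using assms low3 pow by (simp add: env_def s4_def)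
  moreover have "fst s4 ptr = length u + (length u + 1) ^ ?m"
    using assms low3[of 0] pow by (simp add: s4_def)
  ultimately show ?thesis unfolding main using all_digits_correct by simp
qed

section \<open>The complete machine program and its run time\<close>

definition program :: "nat \<Rightarrow> nat list list \<Rightarrow> program" where
  "program r ps = Const 1 1 # compile (main r ps) 1 @ [Load 0 ptr]"

text \<open>Register \<open>0\<close> keeps the input length throughout the compiled code and
  receives the result only from the final \<open>Load\<close>. This instruction and the initial
  \<open>Const\<close> account for the \<open>+ 2\<close>.\<close>

lemma program_halts_within:
  assumes r: "card (set u) = r" and ps: "set ps = permutations_of_set {..<r}"
  shows "halts_within (program r ps) u (cost (length u) (main r ps) + 2) (fw u)"
proof -
  let ?P = "program r ps" and ?c = "main r ps"
  let ?M = "\<lambda>a. if a < length u then u ! a else 0"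
  define s0 where "s0 = (\<lambda>i::nat. if i = 0 then length u else 0, ?M)"
  define s1 where "s1 = assign 1 1 s0"
  define s2 where "s2 = sem ?c s1"
  define s3 where "s3 = assign 0 (snd s2 (fst s2 ptr)) s2"
  have seg0: "segment ?P 0 (Const 1 1 # compile ?c 1 @ [Load 0 ptr])"
    unfolding segment_def program_def by (intro exI[of _ "[]"]) simp
  have seg1: "segment ?P 1 (compile ?c 1 @ [Load 0 ptr])"
    using segment_Cons(3)[OF seg0] by simp
  have seg2: "segment ?P (1 + code_length ?c) [Load 0 ptr]"
    using segment_append(2)[OF seg1] by simp
  have s1: "fst s1 0 = length u" "fst s1 1 = 1" "snd s1 = ?M"
    by (simp_all add: s1_def s0_def)
  have 1: "reaches ?P 1 (config_at 0 s0) (config_at 1 s1)"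
    using reaches_effect[OF seg0, of s0] by (simp add: s1_def)
  have 2: "reaches ?P (cost (length u) ?c) (config_at 1 s1) (config_at (1 + code_length ?c) s2)"
    unfolding s2_def
    by (rule compile_correct[OF well_formed_main segment_append(1)[OF seg1] s1(1,2)])
  have 3: "reaches ?P 1 (config_at (1 + code_length ?c) s2) (config_at (length ?P) s3)"
    using reaches_effect[OF seg2, of s2] by (simp add: s3_def program_def)
  have "fst s3 0 = fw u"
    using main_correct[OF s1(1,2) _ r ps] by (simp add: s3_def s2_def s1(3))
  moreover have "reaches ?P (cost (length u) ?c + 2) (initial u) (config_at (length ?P) s3)"
    using reaches_trans[OF reaches_trans[OF 1 2 order_refl] 3]
    by (simp add: initial_def config_at_def s0_def)
  ultimately show ?thesis
    unfolding reaches_def halts_within_def Let_def halted_def config_at_def by auto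
qed

text \<open>For \<open>n \<ge> 1\<close> the base satisfies \<open>n + 1 \<le> 2 * n\<close>, at the
  price of a factor \<open>2 ^ e\<close>.\<close>

lemma polynomial_bound_bigo:
  fixes T :: "nat \<Rightarrow> nat"
  assumes "\<And>n. T n \<le> K * (n + 1) ^ d" "d \<le> e"
  shows "(\<lambda>n. real (T n)) \<in> O(\<lambda>n. real n ^ e)"
proof (rule bigoI[of _ "real (K * 2 ^ e)"])
  have "real (T n) \<le> real (K * 2 ^ e) * real n ^ e" if "n \<ge> 1" for n
  proof -
    have "(n + 1) ^ d \<le> (n + 1) ^ e" using assms(2) by (intro power_increasing) simp_all
    also have "\<dots> \<le> (2 * n) ^ e" using that by (intro power_mono) simp_all
    finally have "K * (n + 1) ^ d \<le> K * (2 * n) ^ e" by (rule mult_left_mono) simp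
    with assms(1) have "T n \<le> K * (2 * n) ^ e" by (rule order_trans)
    then have "T n \<le> K * 2 ^ e * n ^ e" by (simp add: power_mult_distrib mult.assoc)
    then have "real (T n) \<le> real (K * 2 ^ e * n ^ e)" by (simp only: of_nat_le_iff)
    then show ?thesis by simp
  qed
  then show "\<forall>\<^sub>F n in at_top. norm (real (T n)) \<le> real (K * 2 ^ e) * norm (real n ^ e)"
    by (intro eventually_at_top_linorderI[of 1]) simp
qed

text \<open>The list \<open>ps\<close> depends on \<open>r\<close> alone, so one program serves all
  inputs with \<open>r\<close> letters. It has \<open>fact r\<close> entries, which bounds the loop
  depth and thus the degree of the run time.\<close>

lemma fw_computable:
  "\<exists>P. computes_in_time P {u. card (set u) = r} fw (\<lambda>n. real n ^ (fact r + 2))"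
proof -
  obtain ps where ps: "set ps = permutations_of_set {..<r}" "distinct ps"
    using finite_distinct_list[OF finite_permutations_of_set[of "{..<r}"]] by blast
  then have len: "length ps = fact r" by (metis card_lessThan card_permutations_of_set distinct_card finite_lessThan)
  define c where "c = main r ps"
  obtain K where K: "\<And>n. cost n c \<le> K * (n + 1) ^ depth c" using cost_polynomial by blast
  have "ps \<noteq> []" using len by force
  then have "depth c \<le> fact r + 2" using depth_main[of ps r] len by (simp add: c_def)
  moreover have "cost n c + 2 \<le> (K + 2) * (n + 1) ^ depth c" for n
  proof -
    have "1 \<le> (n + 1) ^ depth c" by simp
    then show ?thesis using K[of n] unfolding add_mult_distrib by linarith
  qed
  ultimately have "(\<lambda>n. real (cost n c + 2)) \<in> O(\<lambda>n. real n ^ (fact r + 2))"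
    by (rule polynomial_bound_bigo[rotated])
  moreover have "halts_within (program r ps) u (cost (length u) c + 2) (fw u)"
    if "card (set u) = r" for u
    unfolding c_def using that ps(1) by (rule program_halts_within)
  ultimately show ?thesis
    unfolding computes_in_time_def
    by (intro exI[of _ "program r ps"] exI[of _ "\<lambda>n. cost n c + 2"]) simp
qed

theorem mainTheorem2:
  "(\<forall>r\<ge>1. \<exists>P. computes_in_time P {u. card (set u) = r} fw (\<lambda>n. real n ^ (fact r + 2))) \<and>
   (\<exists>\<alpha> :: nat \<Rightarrow> nat. \<forall>r\<ge>1. \<exists>P.
      computes_in_time P {u. card (set u) = r} fw (\<lambda>n. real n ^ \<alpha> r))"
  using fw_computable by (intro conjI exI[of _ "\<lambda>r. fact r + 2"]) simp_all

end
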